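(* Let $M$ be a compact two-dimensional $C^\infty$-manifold, let $U$ be a $C^\infty$-manifold diffeomorphic to $\mathbb{R}^3$, let $u_0\in U$ and let $F:M\times U\to\mathbb{R}$ be a $C^\infty$ function. Suppose that $F$ at $u_0$ is right equivalent at the minimum points to one of the normal forms listed below (with $u=(u_1,u_2,u_3)\in\mathbb{R}^3$ and $(x_i,y_i)$ coordinates on the $i$-th copy of $\mathbb{R}^2$). Then the Maxwell set germ $(B_{\rm Maxwell}(F),u_0)$ is diffeomorphic to the germ at $0\in\mathbb{R}^3$ of the corresponding set: (1) $A_1=x^2+y^2$: the empty set. (2) $(A_1,A_1)=(x_1^2+y_1^2+u_1,\ x_2^2+y_2^2)$: the plane $\{u_1=0\}$. (3) $(A_1,A_1,A_1)=(x_1^2+y_1^2+u_1,\ x_2^2+y_2^2+u_2,\ x_3^2+y_3^2)$: the union of three half-planes $$\{u_1=u_2\le0\}\cup\{u_1=0\le u_2\}\cup\{u_2=0\le u_1\}.$$ (4) $(A_1,A_1,A_1,A_1)=(x_1^2+y_1^2+u_1,\ x_2^2+y_2^2+u_2,\ x_3^2+y_3^2+u_3,\ x_4^2+y_4^2)$: the union of six pieces $$\{u_1=u_2\le\min(u_3,0)\}\cup\{u_2=u_3\le\min(u_1,0)\}\cup\{u_3=u_1\le\min(u_2,0)\}$$ $$\cup\{u_1=0\le\min(u_2,u_3)\}\cup\{u_2=0\le\min(u_1,u_3)\}\cup\{u_3=0\le\min(u_1,u_2)\}.$$ (5) $A_3=x^4+u_2x^2+u_1x+y^2$: the open half-plane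 $\{u_1=0,\ u_2<0\}$. (6) $(A_3,A_1)=(x_1^4+u_2x_1^2+u_1x_1+y_1^2+u_3,\ x_2^2+y_2^2)$: the set $M_1\cup M_2$, where $$M_1=\Bigl\{u_1=0,\ u_2<0,\ u_3\le\tfrac{u_2^2}{4}\Bigr\},$$ $$M_2=\Bigl\{|u_1|=\tfrac{\sqrt2}{3\sqrt3}\bigl(\sqrt{u_2^2+12u_3}+2u_2\bigr)\sqrt{\sqrt{u_2^2+12u_3}-u_2}\Bigr\},$$ $M_2$ consisting of those $(u_1,u_2,u_3)\in\mathbb{R}^3$ for which all the square roots are real and the equation holds.
   Context: Notation: $f_u=F(\bullet,u):M\to\mathbb{R}$. The Maxwell set of $F$ is $B_{\rm Maxwell}(F)=\{u\in U: f_u \text{ has two or more global minimum points}\}$. Set germs. Subsets $X,Y$ of a manifold $P$ define the same set germ at $z\in P$ if $X\cap W=Y\cap W$ for some neighbourhood $W$ of $z$; the germ of $X$ at $z$ is written $(X,z)$ ($z$ need not belong to $X$). Germs $(X,z)$ in $P$ and $(Y,w)$ in $P'$ are diffeomorphic if there is a diffeomorphism germ $\theta:(P,z)\to(P',w)$ with $(\theta(X),w)=(Y,w)$. Right equivalence at the minimum points to a normal form. $F$ at $u_0$ is right equivalent at the minimum points to a $k$-tuple $(G_1,\dots,G_k)$ of smooth functions $G_i$ on $\mathbb{R}^2\times\mathbb{R}^3$ (at the origins) if $f_{u_0}$ has exactly $k$ global minimum points $p_1,\dots,p_k$ on $M$ and, after suitable numbering, there are a diffeomorphism germ $\psi:(U,u_0)\to(\mathbb{R}^3,0)$,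 a smooth function germ $\alpha:(U,u_0)\to\mathbb{R}$, and, for each $i$, a smooth map germ $\phi_i:(M\times U,(p_i,u_0))\to(\mathbb{R}^2,0)$ such that $x\mapsto\phi_i(x,u_0)$ is a local diffeomorphism at $p_i$, with $F(x,u)=G_i(\phi_i(x,u),\psi(u))+\alpha(u)$ for $(x,u)$ near $(p_i,u_0)$, $i=1,\dots,k$ (the same $\psi$ and $\alpha$ for all $i$). For $k=1$ the normal form is a single function $G_1$. *)

theory Defs
  imports "HOL-Analysis.Analysis"
begin

text \<open>
  These predicates are meant for open \<open>S\<close>: then they depend only on the values of \<open>f\<close> on \<open>S\<close>.
  Being k times continuously differentiable is expressed through iterated directional derivatives,
  because the type of the k-th Frechet derivative varies with k (in finite dimension, the only case
  used below, the two agree).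
\<close>

fun Ck_on :: "nat \<Rightarrow> 'a::real_normed_vector set \<Rightarrow> ('a \<Rightarrow> 'b::real_normed_vector) \<Rightarrow> bool" where
  "Ck_on 0 S f \<longleftrightarrow> continuous_on S f"
| "Ck_on (Suc k) S f \<longleftrightarrow>
     (\<forall>x\<in>S. f differentiable (at x)) \<and> (\<forall>v. Ck_on k S (\<lambda>x. frechet_derivative f (at x) v))"

definition smooth_on :: "'a::real_normed_vector set \<Rightarrow> ('a \<Rightarrow> 'b::real_normed_vector) \<Rightarrow> bool" where
  "smooth_on S f \<longleftrightarrow> (\<forall>k. Ck_on k S f)"

text \<open>
  Manifolds are without boundary. A manifold consists of a topology, whose \<open>topspace\<close> is the
  underlying set, and an atlas, which need not be maximal. A chart is a pair of a domain and a coordinate map into the model space \<open>'e\<close>;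
  the values of the coordinate map outside the domain are irrelevant.
\<close>

record ('a, 'e) manifold =
  mtop :: "'a topology"
  charts :: "('a set \<times> ('a \<Rightarrow> 'e)) set"

abbreviation mcarrier :: "('a, 'e) manifold \<Rightarrow> 'a set" where
  "mcarrier X \<equiv> topspace (mtop X)"

definition smooth_manifold :: "('a, 'e::euclidean_space) manifold \<Rightarrow> bool" where
  "smooth_manifold X \<longleftrightarrow>
     Hausdorff_space (mtop X) \<and> second_countable (mtop X) \<and>
     mcarrier X = (\<Union>(D, \<phi>)\<in>charts X. D) \<and>
     (\<forall>(D, \<phi>)\<in>charts X. openin (mtop X) D \<and> open (\<phi> ` D) \<and>
        homeomorphic_map (subtopology (mtop X) D) (top_of_set (\<phi> ` D)) \<phi>) \<and>
     (\<forall>(D, \<phi>)\<in>charts X. \<forall>(E, \<psi>)\<in>charts X.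
        smooth_on (\<phi> ` (D \<inter> E)) (\<psi> \<circ> inv_into D \<phi>))"

definition euclid_manifold :: "('e, 'e::euclidean_space) manifold" where
  "euclid_manifold = \<lparr>mtop = euclidean, charts = {(UNIV, \<lambda>x. x)}\<rparr>"

definition prod_manifold ::
    "('a, 'e) manifold \<Rightarrow> ('b, 'f) manifold \<Rightarrow> ('a \<times> 'b, 'e \<times> 'f) manifold" where
  "prod_manifold X Y =
     \<lparr>mtop = prod_topology (mtop X) (mtop Y),
      charts = {(D \<times> E, map_prod \<phi> \<psi>) | D \<phi> E \<psi>. (D, \<phi>) \<in> charts X \<and> (E, \<psi>) \<in> charts Y}\<rparr>"

definition smooth_map_on ::
    "('a, 'e::euclidean_space) manifold \<Rightarrow> ('b, 'f::euclidean_space) manifold \<Rightarrow>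
     'a set \<Rightarrow> ('a \<Rightarrow> 'b) \<Rightarrow> bool" where
  "smooth_map_on X Y W f \<longleftrightarrow>
     openin (mtop X) W \<and> continuous_map (subtopology (mtop X) W) (mtop Y) f \<and>
     (\<forall>(D, \<phi>)\<in>charts X. \<forall>(E, \<psi>)\<in>charts Y.
        smooth_on (\<phi> ` (D \<inter> W \<inter> f -` E)) (\<psi> \<circ> f \<circ> inv_into D \<phi>))"

definition smooth_map ::
    "('a, 'e::euclidean_space) manifold \<Rightarrow> ('b, 'f::euclidean_space) manifold \<Rightarrow>
     ('a \<Rightarrow> 'b) \<Rightarrow> bool" where
  "smooth_map X Y f \<longleftrightarrow> smooth_map_on X Y (mcarrier X) f"

definition diffeo_on ::
    "('a, 'e::euclidean_space) manifold \<Rightarrow> ('b, 'f::euclidean_space) manifold \<Rightarrow>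
     'a set \<Rightarrow> 'b set \<Rightarrow> ('a \<Rightarrow> 'b) \<Rightarrow> bool" where
  "diffeo_on X Y V W f \<longleftrightarrow>
     bij_betw f V W \<and> smooth_map_on X Y V f \<and> smooth_map_on Y X W (inv_into V f)"

definition diffeomorphic_manifolds ::
    "('a, 'e::euclidean_space) manifold \<Rightarrow> ('b, 'f::euclidean_space) manifold \<Rightarrow> bool" where
  "diffeomorphic_manifolds X Y \<longleftrightarrow> (\<exists>f. diffeo_on X Y (mcarrier X) (mcarrier Y) f)"

text \<open>
  Germs of maps are given by representatives, i.e. by total functions of which only the values near
  the base point matter.
\<close>

definition smooth_germ ::
    "('a, 'e::euclidean_space) manifold \<Rightarrow> 'a \<Rightarrow> ('b, 'f::euclidean_space) manifold \<Rightarrow> 'b \<Rightarrow>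
     ('a \<Rightarrow> 'b) \<Rightarrow> bool" where
  "smooth_germ X z Y w f \<longleftrightarrow> f z = w \<and> (\<exists>V. z \<in> V \<and> smooth_map_on X Y V f)"

definition diffeo_germ ::
    "('a, 'e::euclidean_space) manifold \<Rightarrow> 'a \<Rightarrow> ('b, 'f::euclidean_space) manifold \<Rightarrow> 'b \<Rightarrow>
     ('a \<Rightarrow> 'b) \<Rightarrow> bool" where
  "diffeo_germ X z Y w f \<longleftrightarrow> f z = w \<and> (\<exists>V W. z \<in> V \<and> diffeo_on X Y V W f)"

definition same_set_germ :: "('a, 'e) manifold \<Rightarrow> 'a \<Rightarrow> 'a set \<Rightarrow> 'a set \<Rightarrow> bool" where
  "same_set_germ P z X Y \<longleftrightarrow> (\<exists>W. openin (mtop P) W \<and> z \<in> W \<and> X \<inter> W = Y \<inter> W)"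

definition diffeomorphic_set_germs ::
    "('a, 'e::euclidean_space) manifold \<Rightarrow> 'a set \<Rightarrow> 'a \<Rightarrow>
     ('b, 'f::euclidean_space) manifold \<Rightarrow> 'b set \<Rightarrow> 'b \<Rightarrow> bool" where
  "diffeomorphic_set_germs P X z P' Y w \<longleftrightarrow>
     (\<exists>V W \<theta>. z \<in> V \<and> \<theta> z = w \<and> diffeo_on P P' V W \<theta> \<and> same_set_germ P' w (\<theta> ` (X \<inter> V)) Y)"

definition min_points :: "('m, 'e) manifold \<Rightarrow> ('m \<times> 'u \<Rightarrow> real) \<Rightarrow> 'u \<Rightarrow> 'm set" where
  "min_points M F u = {p \<in> mcarrier M. \<forall>q\<in>mcarrier M. F (p, u) \<le> F (q, u)}"

definition Maxwell_set ::
    "('m, 'e) manifold \<Rightarrow> ('u, 'f) manifold \<Rightarrow> ('m \<times> 'u \<Rightarrow> real) \<Rightarrow> 'u set" where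
  "Maxwell_set M U F =
     {u \<in> mcarrier U. \<exists>p\<in>min_points M F u. \<exists>q\<in>min_points M F u. p \<noteq> q}"

text \<open>The tuple of normal forms is a list; the list \<open>ps\<close> is a numbering of the minimum points.\<close>

definition right_equiv_at_min ::
    "('m, real^2) manifold \<Rightarrow> ('u, real^3) manifold \<Rightarrow> ('m \<times> 'u \<Rightarrow> real) \<Rightarrow> 'u \<Rightarrow>
     ((real^2) \<times> (real^3) \<Rightarrow> real) list \<Rightarrow> bool" where
  "right_equiv_at_min M U F u0 Gs \<longleftrightarrow>
     (\<forall>G\<in>set Gs. smooth_on UNIV G) \<and>
     (\<exists>ps \<psi> \<alpha>.
        length ps = length Gs \<and> distinct ps \<and> set ps = min_points M F u0 \<and>
        diffeo_germ U u0 (euclid_manifold :: (real^3, real^3) manifold) 0 \<psi> \<and>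
        smooth_germ U u0 (euclid_manifold :: (real, real) manifold) (\<alpha> u0) \<alpha> \<and>
        (\<forall>i<length Gs. \<exists>\<phi>.
           smooth_germ (prod_manifold M U) (ps ! i, u0)
             (euclid_manifold :: (real^2, real^2) manifold) 0 \<phi> \<and>
           diffeo_germ M (ps ! i) (euclid_manifold :: (real^2, real^2) manifold) 0
             (\<lambda>x. \<phi> (x, u0)) \<and>
           (\<exists>N. openin (mtop (prod_manifold M U)) N \<and> (ps ! i, u0) \<in> N \<and>
              (\<forall>(x, u)\<in>N. F (x, u) = (Gs ! i) (\<phi> (x, u), \<psi> u) + \<alpha> u))))"

end

(*
The minimum points of f_u for u near u_0 stay, by compactness, close to the minimum points p_i of
f_(u_0). The inverse function theorem applied to (x, u) |-> (phi_i(x, u), u) shows that phi_i(., u) maps a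
fixed neighbourhood of p_i injectively onto a set containing a fixed ball about 0. The normal forms
attain their minima, for small parameters, only inside this ball, so the global minimum points of f_u
correspond bijectively to the minimum points of the disjoint union of the functions G_i(., psi(u)) on
copies of R^2. Hence psi itself carries the Maxwell set germ to the set of parameters for which this
disjoint union has two minimum points. For the A_1 families this set compares the constant terms; for the quartic,
two equal minima force an even polynomial, and a minimum value 0 means a factorisation
(t - x)^2 ((t + x)^2 + 2 x^2 + u_2) with nonnegative second factor.
*)

theory Submission
  imports Defs
begin

section \<open>Maxwell sets of the normal forms\<close>

text \<open>A pair \<open>(i, y)\<close> encodes the point \<open>y\<close> of the copy numbered
  \<open>i\<close> (from 0) in a disjoint union of copies of \<open>'y\<close>, one for each entry
  of \<open>Gs\<close>. Minimum points of a whole tuple thus become minimum points of a single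
  function.\<close>

definition least_at :: "('y \<times> 'v \<Rightarrow> real) list \<Rightarrow> 'v \<Rightarrow> nat \<Rightarrow> 'y \<Rightarrow> bool" where
  "least_at Gs v i y \<longleftrightarrow>
     i < length Gs \<and> (\<forall>j<length Gs. \<forall>z. (Gs ! i) (y, v) \<le> (Gs ! j) (z, v))"

definition model_Maxwell :: "('y \<times> 'v \<Rightarrow> real) list \<Rightarrow> 'v set" where
  "model_Maxwell Gs =
     {v. \<exists>i y j z. least_at Gs v i y \<and> least_at Gs v j z \<and> (i, y) \<noteq> (j, z)}"

text \<open>Confines the minimum points for small parameters to a prescribed ball. The comparison is
  with the value at the origin because the origin lies in every such ball: a competitor far away can
  be replaced by one inside.\<close>

definition dominated_by_origin ::
    "('y::real_normed_vector \<times> 'v::real_normed_vector \<Rightarrow> real) \<Rightarrow> bool" where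
  "dominated_by_origin G \<longleftrightarrow>
     (\<forall>r>0. \<exists>e>0. \<forall>v\<in>ball 0 e. \<forall>y. r \<le> norm y \<longrightarrow> G (0, v) < G (y, v))"

text \<open>With the additive term \<open>c\<close> left arbitrary, \<open>A1\<close> and
  \<open>A3\<close> cover every entry of the six normal forms, where \<open>c\<close> is a
  coordinate of the parameter or zero.\<close>

definition A1 :: "(real^3 \<Rightarrow> real) \<Rightarrow> (real^2) \<times> (real^3) \<Rightarrow> real" where
  "A1 c = (\<lambda>(x, u). (x$1)^2 + (x$2)^2 + c u)"

definition A3 :: "(real^3 \<Rightarrow> real) \<Rightarrow> (real^2) \<times> (real^3) \<Rightarrow> real" where
  "A3 c = (\<lambda>(x, u). (x$1)^4 + u$2 * (x$1)^2 + u$1 * x$1 + (x$2)^2 + c u)"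

section \<open>Minimum points of real quartics without cubic term\<close>

lemma quartic_critical_at_minimum:
  fixes a b c x :: real
  assumes "\<And>t. x^4 + b * x^2 + a * x + c \<le> t^4 + b * t^2 + a * t + c"
  shows "4 * x^3 + 2 * b * x + a = 0"
proof (rule DERIV_local_min)
  show "((\<lambda>t. t^4 + b * t^2 + a * t + c) has_real_derivative 4 * x^3 + 2 * b * x + a) (at x)"
    by (auto intro!: derivative_eq_intros)
  show "0 < (1::real)" by simp
qed (use assms in auto)

text \<open>Subtracting the two critical point equations and dividing by \<open>x - y\<close>
  expresses \<open>b\<close>, and then \<open>a\<close>, through \<open>x\<close> and
  \<open>y\<close>. Equality of the two minimum values becomes
  \<open>(x + y) * (x - y)^3 = 0\<close>, so \<open>y = - x\<close> and the polynomial is even up to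
  its constant.\<close>

lemma quartic_two_minimizers:
  fixes a b c x y :: real
  assumes "x \<noteq> y"
    and "\<And>t. x^4 + b * x^2 + a * x + c \<le> t^4 + b * t^2 + a * t + c"
    and "\<And>t. y^4 + b * y^2 + a * y + c \<le> t^4 + b * t^2 + a * t + c"
  shows "a = 0" "b < 0" "x^4 + b * x^2 + a * x + c = c - b^2 / 4"
proof -
  have x: "4 * x^3 + 2 * b * x + a = 0" and y: "4 * y^3 + 2 * b * y + a = 0"
    using quartic_critical_at_minimum assms(2,3) by blast+
  have "(x - y) * (4 * (x^2 + x * y + y^2) + 2 * b) = 0"
    using x y by algebra
  then have b: "b = -2 * (x^2 + x * y + y^2)" using \<open>x \<noteq> y\<close> by auto
  have a: "a = 4 * x * y * (x + y)" using x unfolding b by algebra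
  have "x^4 + b * x^2 + a * x = y^4 + b * y^2 + a * y"
    using assms(2)[of y] assms(3)[of x] by simp
  then have "(x + y) * (x - y)^3 = 0" unfolding a b by algebra
  then have xy: "y = - x" using \<open>x \<noteq> y\<close> by auto
  then have "x \<noteq> 0" using \<open>x \<noteq> y\<close> by auto
  show "a = 0" using a xy by simp
  have b': "b = -2 * x^2" using b xy by (simp add: power2_eq_square)
  then show "b < 0" using \<open>x \<noteq> 0\<close> by simp
  show "x^4 + b * x^2 + a * x + c = c - b^2 / 4"
    using \<open>a = 0\<close> b' by (simp add: field_simps power2_eq_square power4_eq_xxxx)
qed

text \<open>Completing the square: \<open>t^4 + b * t^2 = (t^2 + b / 2)^2 - b^2 / 4\<close>, and the
  square vanishes at \<open>t^2 = - b / 2\<close>.\<close>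

lemma biquadratic_minimizer:
  fixes b t :: real
  assumes "b < 0"
  shows "(sqrt (- b / 2))^4 + b * (sqrt (- b / 2))^2 = - (b^2) / 4"
    and "- (b^2) / 4 \<le> t^4 + b * t^2"
proof -
  have "(sqrt (- b / 2))^2 = - b / 2" using assms by simp
  moreover have "(sqrt (- b / 2))^4 = ((sqrt (- b / 2))^2)^2" by simp
  ultimately show "(sqrt (- b / 2))^4 + b * (sqrt (- b / 2))^2 = - (b^2) / 4"
    by (simp add: power2_eq_square field_simps)
  have "0 \<le> (t^2 + b / 2)^2" by simp
  then show "- (b^2) / 4 \<le> t^4 + b * t^2" by (simp add: power2_eq_square power4_eq_xxxx field_simps)
qed

text \<open>A double root at \<open>x\<close> determines the linear and the constant coefficient
  from \<open>b\<close> and \<open>x\<close>; the missing cubic term makes the two remaining roots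
  symmetric about \<open>- x\<close>.\<close>

lemma quartic_double_root:
  fixes b c t x :: real
  assumes "c = 3 * x^4 + b * x^2"
  shows "t^4 + b * t^2 + (- 2 * x * (2 * x^2 + b)) * t + c = (t - x)^2 * ((t + x)^2 + 2 * x^2 + b)"
  unfolding assms by (simp add: power2_eq_square power4_eq_xxxx algebra_simps)

lemma sqrt_6_abs: "sqrt (6 * x^2) = sqrt 6 * \<bar>x\<bar>"
  by (simp add: real_sqrt_mult)

text \<open>Explains the constant in the equation of the second Maxwell piece: it is applied with
  \<open>k = 2 * x^2 + b\<close> and \<open>l = \<bar>x\<bar>\<close> for a double root
  \<open>x\<close>. Then the two factors after the constant are \<open>3 * k\<close> and
  \<open>sqrt 6 * l\<close>, and the right-hand side is the absolute value of the linear
  coefficient.\<close>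

lemma swallowtail_constant: "sqrt 2 / (3 * sqrt 3) * (3 * k) * (sqrt 6 * l) = 2 * k * l"
proof -
  have "sqrt 6 = sqrt 2 * sqrt 3" by (simp flip: real_sqrt_mult)
  then show ?thesis by (simp add: field_simps)
qed

text \<open>
  With \<open>x\<close> the double root, \<open>sqrt (b^2 + 12 * c) = 6 * x^2 + b\<close>; this is where the square roots in
  \<open>M\<^sub>2\<close> come from.
\<close>

lemma quartic_minimum_zero_iff:
  fixes a b c :: real
  shows "(\<exists>x. x^4 + b * x^2 + a * x + c = 0 \<and> (\<forall>t. 0 \<le> t^4 + b * t^2 + a * t + c)) \<longleftrightarrow>
    0 \<le> b^2 + 12 * c \<and> 0 \<le> sqrt (b^2 + 12 * c) - b \<and>
    \<bar>a\<bar> = sqrt 2 / (3 * sqrt 3) * (sqrt (b^2 + 12 * c) + 2 * b) * sqrt (sqrt (b^2 + 12 * c) - b)"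
    (is "?L \<longleftrightarrow> ?R")
proof
  assume ?L
  then obtain x where x: "x^4 + b * x^2 + a * x + c = 0"
    and nonneg: "\<And>t. 0 \<le> t^4 + b * t^2 + a * t + c" by blast
  have "4 * x^3 + 2 * b * x + a = 0"
    by (rule quartic_critical_at_minimum[of x b a c]) (simp add: x nonneg)
  then have a: "a = - 2 * x * (2 * x^2 + b)" by algebra
  have c: "c = 3 * x^4 + b * x^2" using x unfolding a by algebra
  have prod: "0 \<le> (t - x)^2 * ((t + x)^2 + 2 * x^2 + b)" for t
    using nonneg[of t] quartic_double_root[OF c, of t] a by simp
  \<comment> \<open>The second factor in \<open>prod\<close> is smallest at \<open>t = - x\<close>,
    where the first is positive unless \<open>x = 0\<close>. For \<open>x = 0\<close> the product is
    \<open>t^2 * (t^2 + b)\<close>, which would be negative at \<open>sqrt (- b / 2)\<close> if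
    \<open>b < 0\<close>.\<close>
  have b: "0 \<le> 2 * x^2 + b"
  proof (cases "x = 0")
    case False
    then show ?thesis using prod[of "-x"] by (simp add: zero_le_mult_iff)
  next
    case True
    show ?thesis
    proof (rule ccontr)
      assume "\<not> ?thesis"
      then have "b < 0" using True by simp
      then have "(sqrt (- b / 2))^2 = - b / 2" by simp
      then have "0 \<le> - b / 2 * (- b / 2 + b)" using prod[of "sqrt (- b / 2)"] True by simp
      moreover have "- b / 2 * (- b / 2 + b) < 0" using \<open>b < 0\<close> by (intro mult_pos_neg) auto
      ultimately show False by simp
    qed
  qed
  have D: "b^2 + 12 * c = (6 * x^2 + b)^2" unfolding c by algebra
  have "0 \<le> 6 * x^2 + b" using b zero_le_power2[of x] by linarith
  then have s: "sqrt (b^2 + 12 * c) = 6 * x^2 + b" unfolding D by simp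
  have "\<bar>a\<bar> = 2 * (2 * x^2 + b) * \<bar>x\<bar>" unfolding a using b by (simp add: abs_mult)
  also have "\<dots> = sqrt 2 / (3 * sqrt 3) * (3 * (2 * x^2 + b)) * (sqrt 6 * \<bar>x\<bar>)"
    by (rule swallowtail_constant[symmetric])
  also have "\<dots> = sqrt 2 / (3 * sqrt 3) * (6 * x^2 + b + 2 * b) * sqrt (6 * x^2 + b - b)"
    by (simp add: sqrt_6_abs algebra_simps)
  finally show ?R unfolding s unfolding D by simp
next
  assume R: ?R
  define s where "s = sqrt (b^2 + 12 * c)"
  \<comment> \<open>The absolute value of the double root, found by solving
    \<open>s = 6 * w^2 + b\<close>.\<close>
  define w where "w = sqrt ((s - b) / 6)"
  have w2: "w^2 = (s - b) / 6" and "w \<ge> 0" using R by (auto simp: w_def s_def)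
  then have s: "s = 6 * w^2 + b" by simp
  have "s^2 = b^2 + 12 * c" using R by (simp add: s_def)
  then have c: "c = 3 * w^4 + b * w^2" unfolding s by algebra
  have "\<bar>a\<bar> = sqrt 2 / (3 * sqrt 3) * (6 * w^2 + b + 2 * b) * sqrt (6 * w^2 + b - b)"
    using R by (simp flip: s_def add: s)
  also have "\<dots> = sqrt 2 / (3 * sqrt 3) * (3 * (2 * w^2 + b)) * (sqrt 6 * \<bar>w\<bar>)"
    by (simp add: sqrt_6_abs algebra_simps)
  also have "\<dots> = 2 * (2 * w^2 + b) * w" using \<open>w \<ge> 0\<close> by (simp only: swallowtail_constant abs_of_nonneg)
  finally have a: "\<bar>a\<bar> = 2 * (2 * w^2 + b) * w" .
  \<comment> \<open>For \<open>w > 0\<close> the sign is read off from the equation for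
    \<open>\<bar>a\<bar>\<close>. For \<open>w = 0\<close> that equation says nothing about
    \<open>b\<close>, but then \<open>b = s\<close> is a square root.\<close>
  have b: "0 \<le> 2 * w^2 + b"
  proof (cases "w = 0")
    case True
    then show ?thesis using s R real_sqrt_ge_zero[of "b^2 + 12 * c"] by (simp add: s_def)
  next
    case False
    then have "0 < w" using \<open>w \<ge> 0\<close> by simp
    moreover have "0 \<le> 2 * (2 * w^2 + b) * w" using a by (metis abs_ge_zero)
    ultimately show ?thesis by (simp add: zero_le_mult_iff)
  qed
  \<comment> \<open>As \<open>2 * x^2 + b\<close> is nonnegative, the double root must have the sign
    opposite to that of \<open>a\<close>.\<close>
  obtain x where "x = w \<or> x = - w" and a': "a = - 2 * x * (2 * x^2 + b)"
  proof (cases "a \<ge> 0")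
    case True
    show thesis by (rule that[of "- w"]) (use True a in \<open>auto simp: algebra_simps\<close>)
  next
    case False
    show thesis by (rule that[of w]) (use False a in \<open>auto simp: algebra_simps\<close>)
  qed
  then have x: "c = 3 * x^4 + b * x^2" "0 \<le> 2 * x^2 + b" using b c by auto
  have "t^4 + b * t^2 + a * t + c = (t - x)^2 * ((t + x)^2 + (2 * x^2 + b))" for t
    unfolding a' using quartic_double_root[OF x(1), of t] by (simp add: add.assoc)
  then show ?L using x(2) by (intro exI[of _ x]) auto
qed

section \<open>The \<open>A1\<close> and \<open>A3\<close> families on the plane and their Maxwell
  sets\<close>

lemma vec2_zero_iff: "y = 0 \<longleftrightarrow> y$1 = 0 \<and> y$2 = 0" for y :: "real^2"
  by (simp add: vec_eq_iff forall_2)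

lemma norm_vec2_le: "norm y \<le> \<bar>y$1\<bar> + \<bar>y$2\<bar>" for y :: "real^2"
  using norm_le_l1_cart[of y] by (simp add: UNIV_2)

lemma dominated_by_origin_A1: "dominated_by_origin (A1 c)"
proof -
  have "0 < (y$1)^2 + (y$2)^2" if "y \<noteq> 0" for y :: "real^2"
    using that unfolding vec2_zero_iff by (metis sum_power2_gt_zero_iff)
  then have "A1 c (0, v) < A1 c (y, v)" if "y \<noteq> 0" for v y
    using that by (simp add: A1_def)
  then show ?thesis unfolding dominated_by_origin_def
    by (metis less_numeral_extra(1) linorder_not_le norm_zero)
qed

text \<open>If \<open>norm y\<close> is at least \<open>r\<close>, some coordinate of
  \<open>y\<close> has absolute value at least \<open>k\<close>. With parameters bounded by
  \<open>k^3 / 4\<close>, each perturbing term is at most a quarter of the quartic term when the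
  first coordinate is the large one; otherwise both together are at most \<open>k^2 / 2\<close>,
  while the square of the second coordinate is at least \<open>k^2\<close>.\<close>

lemma dominated_by_origin_A3: "dominated_by_origin (A3 c)"
  unfolding dominated_by_origin_def
proof (intro allI impI)
  fix r :: real assume "0 < r"
  \<comment> \<open>The cap at 1 gives \<open>k^3 \<le> k^2\<close>, which both cases below need;
    the bound \<open>r / 2\<close> leaves room for splitting the norm between two
    coordinates.\<close>
  define k where "k = min 1 (r / 2)"
  have k: "0 < k" "k \<le> 1" "k \<le> r / 2" using \<open>0 < r\<close> by (auto simp: k_def)
  have "A3 c (0, v) < A3 c (y, v)" if "v \<in> ball 0 (k^3 / 4)" "r \<le> norm y" for v y
  proof -
    define x where "x = \<bar>y$1\<bar>"
    have "\<bar>v$i\<bar> \<le> k^3 / 4" for i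
      using that(1) component_le_norm_cart[of v i] by (simp add: dist_norm)
    then have "\<bar>v$i\<bar> * l \<le> k^3 / 4 * l" if "0 \<le> l" for i l
      using that by (intro mult_right_mono)
    then have "\<bar>v$2 * (y$1)^2\<bar> \<le> k^3 / 4 * x^2" "\<bar>v$1 * y$1\<bar> \<le> k^3 / 4 * x"
      by (simp_all only: abs_mult x_def power2_abs abs_power2 zero_le_power2 abs_ge_zero)
    then have lower: "x^4 - k^3 / 4 * x^2 - k^3 / 4 * x + (y$2)^2 \<le> A3 c (y, v) - A3 c (0, v)"
      by (simp add: A3_def x_def abs_le_iff)
    have "0 \<le> x" by (simp add: x_def)
    have "k \<le> x \<or> x < k \<and> k \<le> \<bar>y$2\<bar>"
      using that(2) norm_vec2_le[of y] k(3) by (auto simp: x_def)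
    then have "0 < x^4 - k^3 / 4 * x^2 - k^3 / 4 * x + (y$2)^2"
    proof (elim disjE conjE)
      assume "k \<le> x"
      then have "k^3 \<le> x^3" using k(1) by (intro power_mono) auto
      have "0 < x" using \<open>k \<le> x\<close> k(1) by simp
      have "k^3 * x \<le> x^3 * x" using \<open>k^3 \<le> x^3\<close> \<open>0 < x\<close> by (intro mult_right_mono) auto
      moreover have "k^3 * x^2 \<le> x^2 * x^2"
      proof (intro mult_right_mono)
        have "k^3 \<le> k^2" using k by (intro power_decreasing) auto
        also have "\<dots> \<le> x^2" using \<open>k \<le> x\<close> k(1) by (intro power_mono) auto
        finally show "k^3 \<le> x^2" .
      qed simp
      moreover have "0 < x^4" using \<open>0 < x\<close> by simp
      moreover have "x^3 * x = x^4" "x^2 * x^2 = x^4"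
        by (simp_all add: power2_eq_square power3_eq_cube power4_eq_xxxx)
      ultimately show ?thesis using zero_le_power2[of "y$2"] by linarith
    next
      assume "x < k" "k \<le> \<bar>y$2\<bar>"
      have "k^2 \<le> (y$2)^2" using power_mono[OF \<open>k \<le> \<bar>y$2\<bar>\<close>, of 2] k(1) by simp
      have "x \<le> 1" using \<open>x < k\<close> k by simp
      then have "k^3 * x^2 \<le> k^3 * 1" "k^3 * x \<le> k^3 * 1"
        using \<open>0 \<le> x\<close> k(1) by (intro mult_left_mono; simp add: power_le_one)+
      moreover have "k^3 \<le> k^2" using k by (intro power_decreasing) auto
      moreover have "0 < k^2" "0 \<le> x^4" using k \<open>0 \<le> x\<close> by simp_all
      ultimately show ?thesis using \<open>k^2 \<le> (y$2)^2\<close> by linarith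
    qed
    with lower show ?thesis by linarith
  qed
  then show "\<exists>e>0. \<forall>v\<in>ball 0 e. \<forall>y. r \<le> norm y \<longrightarrow> A3 c (0, v) < A3 c (y, v)"
    using k(1) by (intro exI[of _ "k^3 / 4"]) auto
qed

lemma A1_lower_bound: "(\<forall>z. K \<le> A1 c (z, v)) \<longleftrightarrow> K \<le> c v"
proof
  assume "\<forall>z. K \<le> A1 c (z, v)"
  from this[rule_format, of 0] show "K \<le> c v" by (simp add: A1_def)
qed (simp add: A1_def add_increasing)

lemma A1_attains: "A1 c (y, v) \<le> c v \<longleftrightarrow> y = 0"
  by (simp add: A1_def vec2_zero_iff sum_power2_le_zero_iff)

text \<open>The square of the second coordinate is nonnegative and vanishes on a line, so bounds for
  \<open>A3\<close> from below reduce to the quartic in one variable.\<close>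

lemma A3_lower_bound:
  "(\<forall>z. K \<le> A3 c (z, v)) \<longleftrightarrow> (\<forall>t. K \<le> t^4 + v$2 * t^2 + v$1 * t + c v)"
proof (intro iffI allI)
  fix t
  assume "\<forall>z. K \<le> A3 c (z, v)"
  from this[rule_format, of "vector [t, 0]"] show "K \<le> t^4 + v$2 * t^2 + v$1 * t + c v"
    by (simp add: A3_def)
next
  fix z :: "real^2"
  assume "\<forall>t. K \<le> t^4 + v$2 * t^2 + v$1 * t + c v"
  from this[rule_format, of "z$1"] have "K + 0 \<le> (z$1)^4 + v$2 * (z$1)^2 + v$1 * z$1 + c v + (z$2)^2"
    by (intro add_mono) auto
  then show "K \<le> A3 c (z, v)" by (simp add: A3_def)
qed

lemma A3_minimal_iff:
  "(\<forall>z. A3 c (y, v) \<le> A3 c (z, v)) \<longleftrightarrow> y$2 = 0 \<and>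
     (\<forall>t. (y$1)^4 + v$2 * (y$1)^2 + v$1 * y$1 + c v \<le> t^4 + v$2 * t^2 + v$1 * t + c v)"
proof -
  have "y$2 = 0" if "\<forall>z. A3 c (y, v) \<le> A3 c (z, v)"
    using that[rule_format, of "vector [y$1, 0]"] by (simp add: A3_def)
  then show ?thesis unfolding A3_lower_bound[symmetric] by (auto simp: A3_def)
qed

lemma least_at_A1:
  "least_at (map A1 cs) v i y \<longleftrightarrow> i < length cs \<and> y = 0 \<and> (\<forall>j<length cs. (cs ! i) v \<le> (cs ! j) v)"
proof -
  have "least_at (map A1 cs) v i y \<longleftrightarrow>
      i < length cs \<and> (\<forall>j<length cs. A1 (cs ! i) (y, v) \<le> (cs ! j) v)"
    by (auto simp: least_at_def A1_lower_bound)
  also have "\<dots> \<longleftrightarrow> i < length cs \<and> y = 0 \<and> (\<forall>j<length cs. (cs ! i) v \<le> (cs ! j) v)"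
    using A1_attains[of "cs ! i" y v] by (auto simp: A1_def)
  finally show ?thesis .
qed

text \<open>Each copy has its only minimum point at the origin, so two minimum points lie in
  different copies and only the additive terms compete.\<close>

lemma model_Maxwell_A1:
  "model_Maxwell (map A1 cs) =
     {v. \<exists>i<length cs. \<exists>j<length cs. i \<noteq> j \<and> (cs ! i) v = (cs ! j) v \<and>
           (\<forall>k<length cs. (cs ! i) v \<le> (cs ! k) v)}"
  unfolding model_Maxwell_def least_at_A1 by (auto intro!: Collect_cong) (metis order.antisym)+

lemma least_at_A3:
  "least_at [A3 c] v i y \<longleftrightarrow> i = 0 \<and> y$2 = 0 \<and>
     (\<forall>t. (y$1)^4 + v$2 * (y$1)^2 + v$1 * y$1 + c v \<le> t^4 + v$2 * t^2 + v$1 * t + c v)"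
proof -
  have "least_at [A3 c] v i y \<longleftrightarrow> i = 0 \<and> (\<forall>z. A3 c (y, v) \<le> A3 c (z, v))"
    by (auto simp: least_at_def)
  then show ?thesis unfolding A3_minimal_iff .
qed

lemma least_at_A3_A1:
  "least_at [A3 c, A1 d] v i y \<longleftrightarrow>
     i = 0 \<and> y$2 = 0 \<and> (y$1)^4 + v$2 * (y$1)^2 + v$1 * y$1 + c v \<le> d v \<and>
       (\<forall>t. (y$1)^4 + v$2 * (y$1)^2 + v$1 * y$1 + c v \<le> t^4 + v$2 * t^2 + v$1 * t + c v) \<or>
     i = 1 \<and> y = 0 \<and> (\<forall>t. d v \<le> t^4 + v$2 * t^2 + v$1 * t + c v)"
proof -
  have "least_at [A3 c, A1 d] v i y \<longleftrightarrow>
      i = 0 \<and> (\<forall>z. A3 c (y, v) \<le> A3 c (z, v)) \<and> (\<forall>z. A3 c (y, v) \<le> A1 d (z, v)) \<or>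
      i = 1 \<and> (\<forall>z. A1 d (y, v) \<le> A3 c (z, v)) \<and> (\<forall>z. A1 d (y, v) \<le> A1 d (z, v))"
    by (auto simp: least_at_def less_Suc_eq All_less_Suc)
  also have "\<dots> \<longleftrightarrow>
      i = 0 \<and> y$2 = 0 \<and> (y$1)^4 + v$2 * (y$1)^2 + v$1 * y$1 + c v \<le> d v \<and>
        (\<forall>t. (y$1)^4 + v$2 * (y$1)^2 + v$1 * y$1 + c v \<le> t^4 + v$2 * t^2 + v$1 * t + c v) \<or>
      i = 1 \<and> y = 0 \<and> (\<forall>t. d v \<le> t^4 + v$2 * t^2 + v$1 * t + c v)"
    unfolding A3_minimal_iff A3_lower_bound A1_lower_bound A1_attains
    by (auto simp: A3_def A1_def)
  finally show ?thesis .
qed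

lemma model_Maxwell_A1x1: "model_Maxwell [A1 c] = {}"
  using model_Maxwell_A1[of "[c]"] by simp

lemma model_Maxwell_A1x2: "model_Maxwell [A1 (\<lambda>u. u$1), A1 (\<lambda>u. 0)] = {u. u$1 = 0}"
proof -
  have "model_Maxwell (map A1 [\<lambda>u. u$1, \<lambda>u. 0]) = {u. u$1 = 0}"
    unfolding model_Maxwell_A1 by (auto simp: Ex_less_Suc2 All_less_Suc2)
  then show ?thesis by simp
qed

lemma model_Maxwell_A1x3:
  "model_Maxwell [A1 (\<lambda>u. u$1), A1 (\<lambda>u. u$2), A1 (\<lambda>u. 0)] =
     {u. u$1 = u$2 \<and> u$2 \<le> 0} \<union> {u. u$1 = 0 \<and> 0 \<le> u$2} \<union> {u. u$2 = 0 \<and> 0 \<le> u$1}"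
proof -
  have "model_Maxwell (map A1 [\<lambda>u. u$1, \<lambda>u. u$2, \<lambda>u. 0]) =
     {u. u$1 = u$2 \<and> u$2 \<le> 0} \<union> {u. u$1 = 0 \<and> 0 \<le> u$2} \<union> {u. u$2 = 0 \<and> 0 \<le> u$1}"
    unfolding model_Maxwell_A1
    by (rule set_eqI, simp add: Ex_less_Suc2 All_less_Suc2) (smt (verit))
  then show ?thesis by simp
qed

lemma model_Maxwell_A1x4:
  "model_Maxwell [A1 (\<lambda>u. u$1), A1 (\<lambda>u. u$2), A1 (\<lambda>u. u$3), A1 (\<lambda>u. 0)] =
     {u. u$1 = u$2 \<and> u$2 \<le> min (u$3) 0} \<union> {u. u$2 = u$3 \<and> u$3 \<le> min (u$1) 0}
       \<union> {u. u$3 = u$1 \<and> u$1 \<le> min (u$2) 0} \<union> {u. u$1 = 0 \<and> 0 \<le> min (u$2) (u$3)}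
       \<union> {u. u$2 = 0 \<and> 0 \<le> min (u$1) (u$3)} \<union> {u. u$3 = 0 \<and> 0 \<le> min (u$1) (u$2)}"
    (is "_ = ?R")
proof -
  have "model_Maxwell (map A1 [\<lambda>u. u$1, \<lambda>u. u$2, \<lambda>u. u$3, \<lambda>u. 0]) = ?R"
    unfolding model_Maxwell_A1
    by (rule set_eqI, simp add: Ex_less_Suc2 All_less_Suc2) (smt (verit))
  then show ?thesis by simp
qed

lemma vec2_eq_iff: "y = z \<longleftrightarrow> y$1 = z$1 \<and> y$2 = z$2" for y z :: "real^2"
  by (simp add: vec_eq_iff forall_2)

text \<open>Minimum points have second coordinate 0, so distinct ones differ in the first coordinate
  and give two minimizers of the quartic. Conversely, the even quartic has the two minimizers
  \<open>sqrt (- u$2 / 2)\<close> and its negative.\<close>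

lemma model_Maxwell_A3: "model_Maxwell [A3 (\<lambda>u. 0)] = {u. u$1 = 0 \<and> u$2 < 0}"
proof (intro set_eqI iffI)
  fix v :: "real^3"
  assume "v \<in> model_Maxwell [A3 (\<lambda>u. 0)]"
  then obtain y z where yz: "least_at [A3 (\<lambda>u. 0)] v 0 y" "least_at [A3 (\<lambda>u. 0)] v 0 z" "y \<noteq> z"
    unfolding model_Maxwell_def least_at_A3 by auto
  then have "y$1 \<noteq> z$1" unfolding least_at_A3 by (auto simp: vec2_eq_iff)
  from quartic_two_minimizers(1,2)[OF this, of "v$2" "v$1" 0] yz
  show "v \<in> {u. u$1 = 0 \<and> u$2 < 0}" unfolding least_at_A3 by auto
next
  fix v :: "real^3"
  assume v: "v \<in> {u. u$1 = 0 \<and> u$2 < 0}"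
  define x where "x = sqrt (- v$2 / 2)"
  have "x \<noteq> 0" using v by (simp add: x_def)
  have least: "least_at [A3 (\<lambda>u. 0)] v 0 (vector [y, 0])" if "y = x \<or> y = - x" for y
    using that v biquadratic_minimizer[of "v$2"] by (auto simp: least_at_A3 x_def)
  have "vector [x, 0] \<noteq> (vector [- x, 0] :: real^2)" using \<open>x \<noteq> 0\<close> by (simp add: vec2_eq_iff)
  with least[of x] least[of "- x"] show "v \<in> model_Maxwell [A3 (\<lambda>u. 0)]"
    unfolding model_Maxwell_def by blast
qed

text \<open>\<open>?M1\<close> arises from two minimum points on the quartic copy, whose common
  value \<open>u$3 - (u$2)^2 / 4\<close> must not exceed the minimum 0 of the other copy.
  \<open>?M2\<close> arises from one minimum point on each copy, which means that the quartic has
  minimum value exactly 0.\<close>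

lemma model_Maxwell_A3_A1:
  "model_Maxwell [A3 (\<lambda>u. u$3), A1 (\<lambda>u. 0)] =
     {u. u$1 = 0 \<and> u$2 < 0 \<and> u$3 \<le> (u$2)^2 / 4}
       \<union> {u. 0 \<le> (u$2)^2 + 12 * u$3 \<and> 0 \<le> sqrt ((u$2)^2 + 12 * u$3) - u$2 \<and>
             \<bar>u$1\<bar> = sqrt 2 / (3 * sqrt 3) * (sqrt ((u$2)^2 + 12 * u$3) + 2 * u$2)
                      * sqrt (sqrt ((u$2)^2 + 12 * u$3) - u$2)}"
  (is "?L = ?M1 \<union> ?M2")
proof -
  have M2: "v \<in> ?M2 \<longleftrightarrow> (\<exists>x. x^4 + v$2 * x^2 + v$1 * x + v$3 = 0 \<and>
      (\<forall>t. 0 \<le> t^4 + v$2 * t^2 + v$1 * t + v$3))" for v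
    unfolding quartic_minimum_zero_iff by simp
  note least = least_at_A3_A1[of "\<lambda>u. u$3" "\<lambda>u. 0"]
  show ?thesis
  proof (intro set_eqI iffI)
    fix v :: "real^3"
    assume "v \<in> ?L"
    then obtain i y j z where i: "least_at [A3 (\<lambda>u. u$3), A1 (\<lambda>u. 0)] v i y"
      and j: "least_at [A3 (\<lambda>u. u$3), A1 (\<lambda>u. 0)] v j z" and ne: "(i, y) \<noteq> (j, z)"
      unfolding model_Maxwell_def by blast
    consider "i = 0" "j = 0" | "i = 0" "j = 1" | "i = 1" "j = 0"
      using i j ne unfolding least by auto
    then show "v \<in> ?M1 \<union> ?M2"
    proof cases
      case 1
      then have "y$1 \<noteq> z$1" using i j ne unfolding least by (auto simp: vec2_eq_iff)
      from quartic_two_minimizers[OF this, of "v$2" "v$1" "v$3"] show ?thesis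
        using i j 1 unfolding least by auto
    next
      case 2
      then have "v \<in> ?M2" using i j unfolding least M2 by (auto intro: order.antisym)
      then show ?thesis ..
    next
      case 3
      then have "v \<in> ?M2" using i j unfolding least M2 by (auto intro: order.antisym)
      then show ?thesis ..
    qed
  next
    fix v :: "real^3"
    assume "v \<in> ?M1 \<union> ?M2"
    then show "v \<in> ?L"
    proof
      assume v: "v \<in> ?M1"
      define x where "x = sqrt (- v$2 / 2)"
      have "x \<noteq> 0" using v by (simp add: x_def)
      have l: "least_at [A3 (\<lambda>u. u$3), A1 (\<lambda>u. 0)] v 0 (vector [y, 0])" if "y = x \<or> y = - x" for y
        using that v biquadratic_minimizer[of "v$2"] by (auto simp: least x_def)
      have "vector [x, 0] \<noteq> (vector [- x, 0] :: real^2)"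
        using \<open>x \<noteq> 0\<close> by (simp add: vec2_eq_iff)
      with l[of x] l[of "- x"] show ?thesis unfolding model_Maxwell_def by blast
    next
      assume "v \<in> ?M2"
      then obtain x where x: "x^4 + v$2 * x^2 + v$1 * x + v$3 = 0"
        and nonneg: "\<And>t. 0 \<le> t^4 + v$2 * t^2 + v$1 * t + v$3"
        unfolding M2 by blast
      have "least_at [A3 (\<lambda>u. u$3), A1 (\<lambda>u. 0)] v 0 (vector [x, 0])"
        and "least_at [A3 (\<lambda>u. u$3), A1 (\<lambda>u. 0)] v 1 0"
        using x nonneg unfolding least by auto
      then show ?thesis unfolding model_Maxwell_def by fastforce
    qed
  qed
qed

section \<open>The inverse function theorem with parameters\<close>

lemma Ck_on_subset: "Ck_on k S f \<Longrightarrow> T \<subseteq> S \<Longrightarrow> Ck_on k T f"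
  by (induction k arbitrary: f) (auto intro: continuous_on_subset)

lemma smooth_on_subset: "smooth_on S f \<Longrightarrow> T \<subseteq> S \<Longrightarrow> smooth_on T f"
  unfolding smooth_on_def by (blast intro: Ck_on_subset)

lemma smooth_on_imp_differentiable: "smooth_on S f \<Longrightarrow> x \<in> S \<Longrightarrow> f differentiable (at x)"
  unfolding smooth_on_def by (metis Ck_on.simps(2))

text \<open>\<open>smooth_on\<close> provides continuity of each directional derivative, whereas the
  inverse function theorem asks for a derivative continuous as an operator-valued map. In finite
  dimension this can be tested on the basis vectors.\<close>

lemma smooth_on_imp_continuous_derivative:
  fixes f :: "'a::euclidean_space \<Rightarrow> 'b::real_normed_vector"
  assumes "smooth_on S f"
  obtains f' :: "'a \<Rightarrow> 'a \<Rightarrow>\<^sub>L 'b" where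
    "\<And>x. x \<in> S \<Longrightarrow> (f has_derivative blinfun_apply (f' x)) (at x)" "continuous_on S f'"
proof
  define f' where "f' x = Blinfun (frechet_derivative f (at x))" for x
  have C: "Ck_on (Suc 0) S f" using assms by (simp only: smooth_on_def)
  have blin: "blinfun_apply (f' x) = frechet_derivative f (at x)"
    and deriv: "(f has_derivative frechet_derivative f (at x)) (at x)" if "x \<in> S" for x
  proof -
    show deriv: "(f has_derivative frechet_derivative f (at x)) (at x)"
      using C that by (simp add: frechet_derivative_works)
    show "blinfun_apply (f' x) = frechet_derivative f (at x)"
      unfolding f'_def by (rule bounded_linear_Blinfun_apply[OF has_derivative_bounded_linear[OF deriv]])
  qed
  show "(f has_derivative blinfun_apply (f' x)) (at x)" if "x \<in> S" for x
    using deriv[OF that] blin[OF that] by simp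
  show "continuous_on S f'"
  proof (rule continuous_on_blinfun_componentwise)
    fix i :: 'a
    have "continuous_on S (\<lambda>x. frechet_derivative f (at x) i)" using C by simp
    then show "continuous_on S (\<lambda>x. blinfun_apply (f' x) i)"
      using blin by (simp cong: continuous_on_cong)
  qed
qed

text \<open>Adjoining the parameter as a second component, \<open>H (x, v) = (h (x, v), v)\<close>,
  turns invertibility of the partial derivative in \<open>x\<close> into invertibility of the full
  derivative. Neighbourhoods of product form then make \<open>A\<close> and \<open>r\<close>
  independent of \<open>v\<close>.\<close>

lemma fibrewise_inverse_function:
  fixes h :: "'a::euclidean_space \<times> 'b::euclidean_space \<Rightarrow> 'a"
    and h' :: "'a \<times> 'b \<Rightarrow> ('a \<times> 'b) \<Rightarrow>\<^sub>L 'a"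
  assumes "open S" "(x0, v0) \<in> S"
    and deriv: "\<And>z. z \<in> S \<Longrightarrow> (h has_derivative blinfun_apply (h' z)) (at z)"
    and cont: "continuous_on S h'"
    and inj: "\<And>a. h' (x0, v0) (a, 0) = 0 \<Longrightarrow> a = 0"
  obtains A B r where "open A" "open B" "x0 \<in> A" "v0 \<in> B" "A \<times> B \<subseteq> S" "0 < r"
    "\<And>v. v \<in> B \<Longrightarrow> inj_on (\<lambda>x. h (x, v)) A"
    "\<And>v. v \<in> B \<Longrightarrow> ball (h (x0, v0)) r \<subseteq> (\<lambda>x. h (x, v)) ` A"
proof -
  define H where "H z = (h z, snd z)" for z
  define H' where "H' z = Blinfun (\<lambda>w. (blinfun_apply (h' z) w, snd w))" for z
  have H': "blinfun_apply (H' z) = (\<lambda>w. (blinfun_apply (h' z) w, snd w))" for z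
    unfolding H'_def
    by (intro bounded_linear_Blinfun_apply bounded_linear_Pair blinfun.bounded_linear_right bounded_linear_snd)
  have "linear (H' (x0, v0))" using blinfun.bounded_linear_right by (rule bounded_linear.linear)
  \<comment> \<open>The second component of \<open>H'\<close> is the projection, so every vector in
    the kernel has the form \<open>(a, 0)\<close>.\<close>
  moreover have "inj (H' (x0, v0))"
    by (subst linear_injective_0[OF \<open>linear _\<close>]) (auto simp: H' zero_prod_def dest: inj)
  ultimately obtain g where g: "linear g" "g \<circ> H' (x0, v0) = id"
    using linear_injective_left_inverse by blast
  have "bounded_linear g" using g(1) by (simp add: linear_conv_bounded_linear)
  then have "Blinfun g o\<^sub>L H' (x0, v0) = id_blinfun"
    by (intro blinfun_eqI) (simp add: bounded_linear_Blinfun_apply pointfree_idE[OF g(2)])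
  moreover have "continuous_on S H'"
    by (rule continuous_on_blinfun_componentwise)
      (auto simp: H' intro!: continuous_intros cont)
  moreover have "(H has_derivative blinfun_apply (H' z)) (at z)" if "z \<in> S" for z
    unfolding H_def H'
    by (intro has_derivative_Pair deriv that bounded_linear_imp_has_derivative bounded_linear_snd)
  ultimately obtain S' T k where "open S'" "S' \<subseteq> S" "(x0, v0) \<in> S'" and hom: "homeomorphism S' T H k"
    and "open T"
    by - (rule inverse_function_theorem[OF \<open>open S\<close> _ _ \<open>(x0, v0) \<in> S\<close>, of H H' "Blinfun g"])
  obtain A B0 where A: "open A" "x0 \<in> A" and B0: "open B0" "v0 \<in> B0" and AB0: "A \<times> B0 \<subseteq> S'"
    using \<open>open S'\<close> \<open>(x0, v0) \<in> S'\<close> by (auto elim!: open_prod_elim)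
  have "open (H ` (A \<times> B0))"
    using homeomorphism_imp_open_map[OF hom, of "A \<times> B0"] AB0 A(1) B0(1) \<open>open T\<close> \<open>open S'\<close>
    by (metis open_Times open_subset openin_open_trans)
  moreover have "(h (x0, v0), v0) \<in> H ` (A \<times> B0)" using A B0 by (force simp: H_def)
  \<comment> \<open>\<open>B\<close> is chosen after \<open>A\<close>, inside the image of
    \<open>A \<times> B0\<close>, so the preimages found in \<open>fibre\<close> lie in the same
    \<open>A\<close> for every \<open>v\<close> in \<open>B\<close>.\<close>
  ultimately obtain C B where "open C" "h (x0, v0) \<in> C" and B: "open B" "v0 \<in> B"
    and CB: "C \<times> B \<subseteq> H ` (A \<times> B0)"
    by (auto elim!: open_prod_elim)
  obtain r where r: "0 < r" "ball (h (x0, v0)) r \<subseteq> C"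
    using \<open>open C\<close> \<open>h (x0, v0) \<in> C\<close> openE by blast
  have fibre: "\<exists>x\<in>A. h (x, v) = y" if "y \<in> C" "v \<in> B" for y v
    using CB that by (force simp: H_def)
  have "B \<subseteq> B0" using CB \<open>h (x0, v0) \<in> C\<close> by (force simp: H_def)
  show thesis
  proof
    show "A \<times> B \<subseteq> S" using AB0 \<open>B \<subseteq> B0\<close> \<open>S' \<subseteq> S\<close> by blast
    show "ball (h (x0, v0)) r \<subseteq> (\<lambda>x. h (x, v)) ` A" if "v \<in> B" for v
      using fibre that r(2) by blast
    show "inj_on (\<lambda>x. h (x, v)) A" if "v \<in> B" for v
    proof (rule inj_onI)
      fix x y assume "x \<in> A" "y \<in> A" "h (x, v) = h (y, v)"
      then have "(x, v) \<in> S'" "(y, v) \<in> S'" "H (x, v) = H (y, v)"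
        using AB0 \<open>B \<subseteq> B0\<close> that by (auto simp: H_def)
      then show "x = y" by (metis hom homeomorphism_apply1 prod.inject)
    qed
  qed (use A B r in auto)
qed

section \<open>Passage to manifolds through charts\<close>

lemma smooth_manifold_chart:
  assumes "smooth_manifold X" "z \<in> mcarrier X"
  obtains D \<xi> where "(D, \<xi>) \<in> charts X" "z \<in> D" "openin (mtop X) D" "inj_on \<xi> D"
    "\<forall>P. openin (mtop X) P \<longrightarrow> P \<subseteq> D \<longrightarrow> open (\<xi> ` P)"
    "\<forall>Q. open Q \<longrightarrow> openin (mtop X) (D \<inter> \<xi> -` Q)"
proof -
  obtain D \<xi> where D: "(D, \<xi>) \<in> charts X" "z \<in> D"
    using assms unfolding smooth_manifold_def by blast
  then have open_D: "openin (mtop X) D" and im: "open (\<xi> ` D)"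
    and hom: "homeomorphic_map (subtopology (mtop X) D) (top_of_set (\<xi> ` D)) \<xi>"
    using assms(1) unfolding smooth_manifold_def by blast+
  have top: "topspace (subtopology (mtop X) D) = D"
    using openin_subset[OF open_D] by (simp add: Int_absorb1)
  show thesis
  proof
    show "inj_on \<xi> D" using homeomorphic_imp_injective_map[OF hom] top by simp
    show "\<forall>P. openin (mtop X) P \<longrightarrow> P \<subseteq> D \<longrightarrow> open (\<xi> ` P)"
    proof (intro allI impI)
      fix P assume that: "openin (mtop X) P" "P \<subseteq> D"
      have "openin (subtopology (mtop X) D) P" using that by (simp add: openin_subset_topspace_eq openin_open_subtopology open_D)
      then have "openin (top_of_set (\<xi> ` D)) (\<xi> ` P)"
        using homeomorphic_imp_open_map[OF hom] by (simp add: open_map_def)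
      then show "open (\<xi> ` P)" using im openin_open_trans by blast
    qed
    show "\<forall>Q. open Q \<longrightarrow> openin (mtop X) (D \<inter> \<xi> -` Q)"
    proof (intro allI impI)
      fix Q :: "'b set" assume that: "open Q"
      have "openin (top_of_set (\<xi> ` D)) (\<xi> ` D \<inter> Q)" using that by (simp add: openin_open_Int)
      then have "openin (subtopology (mtop X) D) {x \<in> D. \<xi> x \<in> \<xi> ` D \<inter> Q}"
        using openin_continuous_map_preimage[OF homeomorphic_imp_continuous_map[OF hom]]
        unfolding top by blast
      moreover have "{x \<in> D. \<xi> x \<in> \<xi> ` D \<inter> Q} = D \<inter> \<xi> -` Q" by auto
      ultimately show "openin (mtop X) (D \<inter> \<xi> -` Q)"
        using open_D by (simp add: openin_open_subtopology)
    qed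
  qed (use D open_D in auto)
qed

lemma smooth_map_on_chartsD:
  assumes "smooth_map_on X Y W f" "(D, \<phi>) \<in> charts X" "(E, \<psi>) \<in> charts Y"
  shows "smooth_on (\<phi> ` (D \<inter> W \<inter> f -` E)) (\<psi> \<circ> f \<circ> inv_into D \<phi>)"
proof -
  have "\<forall>(D, \<phi>)\<in>charts X. \<forall>(E, \<psi>)\<in>charts Y.
      smooth_on (\<phi> ` (D \<inter> W \<inter> f -` E)) (\<psi> \<circ> f \<circ> inv_into D \<phi>)"
    using assms(1) unfolding smooth_map_on_def by (elim conjE)
  from bspec[OF bspec[OF this assms(2), unfolded prod.case] assms(3)] show ?thesis by simp
qed

lemma chart_euclid_manifold: "(UNIV, \<lambda>x. x) \<in> charts euclid_manifold"
  by (simp add: euclid_manifold_def)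

lemma chart_prod_manifold:
  "(D, \<phi>) \<in> charts X \<Longrightarrow> (E, \<psi>) \<in> charts Y \<Longrightarrow>
     (D \<times> E, map_prod \<phi> \<psi>) \<in> charts (prod_manifold X Y)"
  by (auto simp: prod_manifold_def)

lemma openin_prod_manifold_rectangle:
  assumes "openin (mtop (prod_manifold X Y)) N" "(p, q) \<in> N"
  obtains P Q where "openin (mtop X) P" "openin (mtop Y) Q" "p \<in> P" "q \<in> Q" "P \<times> Q \<subseteq> N"
proof -
  have "openin (prod_topology (mtop X) (mtop Y)) N" using assms(1) by (simp add: prod_manifold_def)
  then have "\<exists>P Q. openin (mtop X) P \<and> openin (mtop Y) Q \<and> p \<in> P \<and> q \<in> Q \<and> P \<times> Q \<subseteq> N"
    using assms(2) by (simp only: openin_prod_topology_alt)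
  then show thesis using that by (elim exE conjE)
qed

text \<open>Charts reduce this to the Euclidean case. Injectivity of the partial derivative comes
  from the chain rule, applied to the smooth local inverse of \<open>\<phi>\<close> at the fixed
  parameter \<open>u0\<close>.\<close>

lemma manifold_fibrewise_inverse_function:
  fixes M :: "('m, 'e::euclidean_space) manifold" and U :: "('u, 'f::euclidean_space) manifold"
    and \<phi> :: "'m \<times> 'u \<Rightarrow> 'e"
  assumes M: "smooth_manifold M" and U: "smooth_manifold U"
    and smooth: "smooth_germ (prod_manifold M U) (p, u0) euclid_manifold w \<phi>"
    and diffeo: "diffeo_germ M p euclid_manifold w (\<lambda>x. \<phi> (x, u0))"
    and N: "openin (mtop (prod_manifold M U)) N" "(p, u0) \<in> N"
  obtains A B r where "openin (mtop M) A" "openin (mtop U) B" "p \<in> A" "u0 \<in> B" "A \<times> B \<subseteq> N"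
    "0 < r" "\<And>u. u \<in> B \<Longrightarrow> inj_on (\<lambda>x. \<phi> (x, u)) A"
    "\<And>u. u \<in> B \<Longrightarrow> ball w r \<subseteq> (\<lambda>x. \<phi> (x, u)) ` A"
proof -
  define f where "f = (\<lambda>x. \<phi> (x, u0))"
  obtain W where W: "(p, u0) \<in> W" "smooth_map_on (prod_manifold M U) euclid_manifold W \<phi>"
    using smooth unfolding smooth_germ_def by blast
  then have "openin (mtop (prod_manifold M U)) (W \<inter> N)" "(p, u0) \<in> W \<inter> N"
    using N by (auto simp: smooth_map_on_def)
  then obtain P Q where PQ: "openin (mtop M) P" "openin (mtop U) Q" "p \<in> P" "u0 \<in> Q"
    "P \<times> Q \<subseteq> W \<inter> N"
    by (rule openin_prod_manifold_rectangle)
  obtain V V' where V: "p \<in> V" "diffeo_on M euclid_manifold V V' f" and "f p = w"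
    using diffeo unfolding diffeo_germ_def f_def by blast
  then have bij: "bij_betw f V V'" and "openin (mtop M) V"
    by (auto simp: diffeo_on_def smooth_map_on_def)
  have "p \<in> mcarrier M" "u0 \<in> mcarrier U" using PQ openin_subset by blast+
  obtain D \<xi> where D: "(D, \<xi>) \<in> charts M" "p \<in> D" "openin (mtop M) D" "inj_on \<xi> D"
    and open_D': "\<forall>P. openin (mtop M) P \<longrightarrow> P \<subseteq> D \<longrightarrow> open (\<xi> ` P)"
      "\<forall>Q. open Q \<longrightarrow> openin (mtop M) (D \<inter> \<xi> -` Q)"
    by (rule smooth_manifold_chart[OF M \<open>p \<in> mcarrier M\<close>])
  note open_D = open_D'[rule_format]
  obtain E \<eta> where E: "(E, \<eta>) \<in> charts U" "u0 \<in> E" "openin (mtop U) E" "inj_on \<eta> E"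
    and open_E': "\<forall>P. openin (mtop U) P \<longrightarrow> P \<subseteq> E \<longrightarrow> open (\<eta> ` P)"
      "\<forall>Q. open Q \<longrightarrow> openin (mtop U) (E \<inter> \<eta> -` Q)"
    by (rule smooth_manifold_chart[OF U \<open>u0 \<in> mcarrier U\<close>])
  note open_E = open_E'[rule_format]
  define P' where "P' = P \<inter> D \<inter> V"
  define Q' where "Q' = Q \<inter> E"
  define S where "S = (\<xi> ` P') \<times> (\<eta> ` Q')"
  define h where "h = \<phi> \<circ> inv_into (D \<times> E) (map_prod \<xi> \<eta>)"
  have h: "h (\<xi> x, \<eta> u) = \<phi> (x, u)" if "x \<in> D" "u \<in> E" for x u
  proof -
    have "inv_into (D \<times> E) (map_prod \<xi> \<eta>) (map_prod \<xi> \<eta> (x, u)) = (x, u)"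
      using that by (intro inv_into_f_f map_prod_inj_on D E) auto
    then show ?thesis by (simp add: h_def)
  qed
  have "open (\<xi> ` P')" unfolding P'_def
    using PQ(1) D(3) \<open>openin (mtop M) V\<close> by (intro open_D) auto
  have "open (\<eta> ` Q')" unfolding Q'_def using PQ(2) E(3) by (intro open_E) auto
  have "open S" unfolding S_def using \<open>open (\<xi> ` P')\<close> \<open>open (\<eta> ` Q')\<close> by (rule open_Times)
  have "p \<in> P'" "u0 \<in> Q'" using PQ D(2) E(2) V(1) by (auto simp: P'_def Q'_def)
  then have "(\<xi> p, \<eta> u0) \<in> S" by (auto simp: S_def)
  have "smooth_on (map_prod \<xi> \<eta> ` (D \<times> E \<inter> W \<inter> \<phi> -` UNIV))
      ((\<lambda>x. x) \<circ> \<phi> \<circ> inv_into (D \<times> E) (map_prod \<xi> \<eta>))"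
    by (rule smooth_map_on_chartsD[OF W(2) chart_prod_manifold[OF D(1) E(1)] chart_euclid_manifold])
  then have "smooth_on (map_prod \<xi> \<eta> ` (D \<times> E \<inter> W)) h" by (simp add: h_def comp_def)
  moreover have "S \<subseteq> map_prod \<xi> \<eta> ` (D \<times> E \<inter> W)"
    using PQ(5) by (force simp: S_def P'_def Q'_def)
  ultimately have "smooth_on S h" by (rule smooth_on_subset)
  then obtain h' where h': "\<And>z. z \<in> S \<Longrightarrow> (h has_derivative blinfun_apply (h' z)) (at z)"
    and cont: "continuous_on S h'"
    using smooth_on_imp_continuous_derivative by blast

  \<comment> \<open>\<open>k\<close> is the local inverse of \<open>f\<close> read in the chart
    \<open>\<xi>\<close>; its derivative at \<open>w\<close> will be a left inverse of the partial
    derivative of \<open>h\<close>.\<close>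
  define g where "g = inv_into V f"
  define k where "k = \<xi> \<circ> g"
  have g: "g (f x) = x" if "x \<in> V" for x
    using bij that by (simp add: g_def bij_betw_inv_into_left)
  have "smooth_map_on euclid_manifold M V' g" using V(2) by (simp add: diffeo_on_def g_def)
  from smooth_map_on_chartsD[OF this chart_euclid_manifold D(1)]
  have "smooth_on ((\<lambda>x. x) ` (UNIV \<inter> V' \<inter> g -` D)) (\<xi> \<circ> g \<circ> inv_into UNIV (\<lambda>x. x))" .
  moreover have "inv_into UNIV (\<lambda>x. x) = (\<lambda>x::'e. x)" by (rule inv_equality) auto
  ultimately have "smooth_on (V' \<inter> g -` D) k" by (simp add: k_def comp_def)
  moreover have "w \<in> V' \<inter> g -` D"
    using bij V(1) \<open>f p = w\<close> g[OF V(1)] D(2) by (auto simp: bij_betw_def)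
  ultimately obtain k' where k': "(k has_derivative k') (at w)"
    using smooth_on_imp_differentiable unfolding differentiable_def by blast
  have hp: "h (\<xi> p, \<eta> u0) = w" using h D(2) E(2) \<open>f p = w\<close> by (simp add: f_def)
  have inj: "a = 0" if "h' (\<xi> p, \<eta> u0) (a, 0) = 0" for a
  proof -
    have "((\<lambda>x. (x, \<eta> u0)) has_derivative (\<lambda>a. (a, 0))) (at (\<xi> p))"
      by (auto intro!: derivative_eq_intros)
    from has_derivative_compose[OF this, of h, OF h'[OF \<open>(\<xi> p, \<eta> u0) \<in> S\<close>]]
    have "((\<lambda>x. h (x, \<eta> u0)) has_derivative (\<lambda>a. h' (\<xi> p, \<eta> u0) (a, 0))) (at (\<xi> p))" .
    from has_derivative_compose[OF this, of k k', unfolded hp, OF k']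
    have kh: "((\<lambda>x. k (h (x, \<eta> u0))) has_derivative (\<lambda>a. k' (h' (\<xi> p, \<eta> u0) (a, 0)))) (at (\<xi> p))" .
    \<comment> \<open>On the image of \<open>P'\<close>, which lies in that of \<open>V\<close>, the
      composition is the identity; uniqueness of derivatives then identifies the two linear
      maps.\<close>
    have "((\<lambda>x. k (h (x, \<eta> u0))) has_derivative (\<lambda>a. a)) (at (\<xi> p))"
    proof (rule has_derivative_transform_within_open[OF has_derivative_ident \<open>open (\<xi> ` P')\<close>])
      fix x assume "x \<in> \<xi> ` P'"
      then obtain y where y: "y \<in> P'" "x = \<xi> y" by blast
      then have "h (x, \<eta> u0) = f y" using h E(2) by (simp add: P'_def f_def)
      then show "x = k (h (x, \<eta> u0))" using g y by (simp add: k_def P'_def)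
    qed (use \<open>p \<in> P'\<close> in auto)
    from fun_cong[OF has_derivative_unique[OF kh this], of a]
    have "k' (h' (\<xi> p, \<eta> u0) (a, 0)) = a" .
    then show "a = 0" using that linear_0[OF has_derivative_linear[OF k']] by simp
  qed
  obtain A' B' r where AB': "open A'" "open B'" "\<xi> p \<in> A'" "\<eta> u0 \<in> B'" "A' \<times> B' \<subseteq> S" "0 < r"
    and inj': "\<And>v. v \<in> B' \<Longrightarrow> inj_on (\<lambda>x. h (x, v)) A'"
    and surj': "\<And>v. v \<in> B' \<Longrightarrow> ball w r \<subseteq> (\<lambda>x. h (x, v)) ` A'"
    using fibrewise_inverse_function[OF \<open>open S\<close> \<open>(\<xi> p, \<eta> u0) \<in> S\<close> h' cont inj] hp by metis
  have sub: "A' \<subseteq> \<xi> ` P'" "B' \<subseteq> \<eta> ` Q'" using AB'(3-5) by (auto simp: S_def)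
  define A where "A = D \<inter> \<xi> -` A'"
  define B where "B = E \<inter> \<eta> -` B'"
  \<comment> \<open>A point of \<open>D\<close> with the same coordinates as a point of
    \<open>P'\<close> equals it, because \<open>\<xi>\<close> is injective on
    \<open>D\<close>.\<close>
  have "A \<subseteq> P'" using sub(1) inj_onD[OF D(4)] by (fastforce simp: A_def P'_def)
  have "B \<subseteq> Q'" using sub(2) inj_onD[OF E(4)] by (fastforce simp: B_def Q'_def)
  show thesis
  proof
    show "openin (mtop M) A" "openin (mtop U) B"
      unfolding A_def B_def using open_D(2) open_E(2) AB'(1,2) by auto
    show "p \<in> A" "u0 \<in> B" using D(2) E(2) AB'(3,4) by (auto simp: A_def B_def)
    show "A \<times> B \<subseteq> N" using \<open>A \<subseteq> P'\<close> \<open>B \<subseteq> Q'\<close> PQ(5) by (auto simp: P'_def Q'_def)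
    show "0 < r" by fact
    fix u assume "u \<in> B"
    then have u: "u \<in> E" "\<eta> u \<in> B'" by (auto simp: B_def)
    show "inj_on (\<lambda>x. \<phi> (x, u)) A"
    proof (rule inj_onI)
      fix x y assume xy: "x \<in> A" "y \<in> A" "\<phi> (x, u) = \<phi> (y, u)"
      then have "h (\<xi> x, \<eta> u) = h (\<xi> y, \<eta> u)" using h u by (simp add: A_def)
      then have "\<xi> x = \<xi> y" using inj_onD[OF inj'[OF u(2)]] xy by (auto simp: A_def)
      then show "x = y" using inj_onD[OF D(4)] xy by (auto simp: A_def)
    qed
    show "ball w r \<subseteq> (\<lambda>x. \<phi> (x, u)) ` A"
    proof
      fix y assume "y \<in> ball w r"
      then obtain x where "x \<in> A'" "y = h (x, \<eta> u)" using surj'[OF u(2)] by blast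
      moreover from this obtain a where "a \<in> P'" "x = \<xi> a" using sub(1) by blast
      ultimately have "a \<in> A" "y = \<phi> (a, u)" using h u by (auto simp: A_def P'_def)
      then show "y \<in> (\<lambda>x. \<phi> (x, u)) ` A" by blast
    qed
  qed
qed

section \<open>The Maxwell set germ\<close>

text \<open>The map sending \<open>x\<close> in \<open>A i\<close> to \<open>(i, \<Phi> i x)\<close>
  matches the points of \<open>mins\<close> with the least points of the disjoint union. Inside the
  balls, values of the model are values of \<open>f\<close> up to the common constant
  \<open>\<alpha>\<close>; outside them, \<open>dom\<close> applies.\<close>

lemma two_minimizers_iff_model_Maxwell:
  fixes f :: "'m \<Rightarrow> real" and X :: "'m set" and \<Phi> :: "nat \<Rightarrow> 'm \<Rightarrow> 'y::real_normed_vector"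
    and Gs :: "('y \<times> 'v \<Rightarrow> real) list"
  defines "mins \<equiv> {p \<in> X. \<forall>q\<in>X. f p \<le> f q}"
  assumes "mins \<noteq> {}" and cover: "mins \<subseteq> (\<Union>i<length Gs. A i)"
    and A: "\<And>i. i < length Gs \<Longrightarrow> A i \<subseteq> X"
    and disjoint: "\<And>i j. i < length Gs \<Longrightarrow> j < length Gs \<Longrightarrow> i \<noteq> j \<Longrightarrow> A i \<inter> A j = {}"
    and inj: "\<And>i. i < length Gs \<Longrightarrow> inj_on (\<Phi> i) (A i)"
    and surj: "\<And>i. i < length Gs \<Longrightarrow> ball 0 (r i) \<subseteq> \<Phi> i ` A i"
    and f: "\<And>i x. i < length Gs \<Longrightarrow> x \<in> A i \<Longrightarrow> f x = (Gs ! i) (\<Phi> i x, v) + \<alpha>"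
    and r: "\<And>i. i < length Gs \<Longrightarrow> 0 < r i"
    and dom: "\<And>i y. i < length Gs \<Longrightarrow> r i \<le> norm y \<Longrightarrow> (Gs ! i) (0, v) < (Gs ! i) (y, v)"
  shows "(\<exists>p\<in>mins. \<exists>q\<in>mins. p \<noteq> q) \<longleftrightarrow> v \<in> model_Maxwell Gs"
proof
  assume "\<exists>p\<in>mins. \<exists>q\<in>mins. p \<noteq> q"
  then obtain p q where pq: "p \<in> mins" "q \<in> mins" "p \<noteq> q" by blast
  have least: "least_at Gs v i (\<Phi> i x)" if "x \<in> mins" "i < length Gs" "x \<in> A i" for x i
    unfolding least_at_def
  proof (intro conjI allI impI)
    fix j z assume j: "j < length Gs"
    \<comment> \<open>A competitor outside the ball is replaced by the origin, which has a smaller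
      value and a preimage in \<open>A j\<close>.\<close>
    obtain z' where "norm z' < r j" and le: "(Gs ! j) (z', v) \<le> (Gs ! j) (z, v)"
    proof (cases "norm z < r j")
      case True
      then show thesis by (rule that) simp
    next
      case False
      then show thesis using dom[OF j, of z] r[OF j] by (intro that[of 0]) auto
    qed
    then obtain q where q: "q \<in> A j" "z' = \<Phi> j q" using subsetD[OF surj[OF j], of z'] by auto
    have "f x \<le> f q" using that(1) subsetD[OF A[OF j] q(1)] by (simp add: mins_def)
    then have "(Gs ! i) (\<Phi> i x, v) \<le> (Gs ! j) (z', v)"
      unfolding f[OF that(2,3)] f[OF j q(1)] q(2) by simp
    with le show "(Gs ! i) (\<Phi> i x, v) \<le> (Gs ! j) (z, v)" by simp
  qed (rule that)
  obtain i where i: "i < length Gs" "p \<in> A i" using subsetD[OF cover pq(1)] by auto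
  obtain j where j: "j < length Gs" "q \<in> A j" using subsetD[OF cover pq(2)] by auto
  have "(i, \<Phi> i p) \<noteq> (j, \<Phi> j q)"
    using inj_onD[OF inj[OF i(1)], of p q] i(2) j(2) pq(3) by auto
  with least[OF pq(1) i] least[OF pq(2) j] show "v \<in> model_Maxwell Gs"
    unfolding model_Maxwell_def by blast
next
  assume "v \<in> model_Maxwell Gs"
  then obtain i y j z where iy: "least_at Gs v i y" and jz: "least_at Gs v j z"
    and ne: "(i, y) \<noteq> (j, z)"
    unfolding model_Maxwell_def by blast
  have point: "\<exists>x\<in>A i. \<Phi> i x = y \<and> x \<in> mins" if L: "least_at Gs v i y" for i y
  proof -
    have i: "i < length Gs" using L by (simp add: least_at_def)
    have "norm y < r i"
    proof (rule ccontr)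
      assume "\<not> norm y < r i"
      then have "(Gs ! i) (0, v) < (Gs ! i) (y, v)" using dom[OF i, of y] by simp
      moreover have "(Gs ! i) (y, v) \<le> (Gs ! i) (0, v)" using L i by (simp add: least_at_def)
      ultimately show False by simp
    qed
    then obtain x where x: "x \<in> A i" "y = \<Phi> i x" using subsetD[OF surj[OF i], of y] by auto
    have "x \<in> mins"
    proof -
      \<comment> \<open>Points of \<open>X\<close> outside all \<open>A k\<close> are not seen by
        the model. An existing minimum point, which does lie in some \<open>A k\<close>, carries the
        comparison over to all of \<open>X\<close>.\<close>
      obtain p where p: "p \<in> mins" using \<open>mins \<noteq> {}\<close> by blast
      then obtain k where k: "k < length Gs" "p \<in> A k" using subsetD[OF cover, of p] by auto
      have "f x \<le> f p"
        unfolding f[OF i x(1)] f[OF k] using L k(1) x(2) by (simp add: least_at_def)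
      then have "f x \<le> f q" if "q \<in> X" for q
        using p that by (auto simp: mins_def intro: order_trans[of "f x" "f p"])
      then show ?thesis using subsetD[OF A[OF i] x(1)] unfolding mins_def by blast
    qed
    then show ?thesis using x by blast
  qed
  obtain x x' where x: "x \<in> A i" "\<Phi> i x = y" "x \<in> mins" and x': "x' \<in> A j" "\<Phi> j x' = z" "x' \<in> mins"
    using point[OF iy] point[OF jz] by blast
  have "x \<noteq> x'"
  proof
    assume "x = x'"
    moreover have "i < length Gs" "j < length Gs" using iy jz by (simp_all add: least_at_def)
    ultimately have "i = j" using disjoint[of i j] x(1) x'(1) by blast
    then show False using ne x(2) x'(2) \<open>x = x'\<close> by simp
  qed
  then show "\<exists>p\<in>mins. \<exists>q\<in>mins. p \<noteq> q" using x x' by blast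
qed

section \<open>Separation and compactness\<close>

lemma Hausdorff_space_separate_finite:
  assumes "Hausdorff_space X" "inj_on p {..<n::nat}" "p ` {..<n} \<subseteq> topspace X"
  obtains S where "\<And>i. i < n \<Longrightarrow> openin X (S i) \<and> p i \<in> S i"
    "\<And>i j. i < n \<Longrightarrow> j < n \<Longrightarrow> i \<noteq> j \<Longrightarrow> S i \<inter> S j = {}"
proof -
  have "\<exists>P Q. openin X P \<and> openin X Q \<and> p i \<in> P \<and> p j \<in> Q \<and> P \<inter> Q = {}"
    if "i < n" "j < n" "i \<noteq> j" for i j
  proof -
    have "p i \<in> topspace X" "p j \<in> topspace X" using assms(3) that by auto
    moreover have "p i \<noteq> p j" using inj_onD[OF assms(2), of i j] that by auto
    ultimately show ?thesis using assms(1) unfolding Hausdorff_space_def disjnt_def by blast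
  qed
  then obtain P Q where PQ: "\<And>i j. i < n \<Longrightarrow> j < n \<Longrightarrow> i \<noteq> j \<Longrightarrow>
      openin X (P i j) \<and> openin X (Q i j) \<and> p i \<in> P i j \<and> p j \<in> Q i j \<and> P i j \<inter> Q i j = {}"
    by metis
  \<comment> \<open>The chosen \<open>P\<close> and \<open>Q\<close> need not be symmetric in the
    indices, so \<open>S i\<close> is placed in its sets for both orders of each pair. The factor
    \<open>topspace X\<close> keeps \<open>S i\<close> open when there is only one point and the
    intersection is empty.\<close>
  define S where "S i = topspace X \<inter> (\<Inter>j\<in>{..<n} - {i}. P i j \<inter> Q j i)" for i
  show thesis
  proof
    show "openin X (S i) \<and> p i \<in> S i" if "i < n" for i
    proof
      show "openin X (S i)" unfolding S_def
        using PQ that by (intro openin_Int_Inter) auto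
      show "p i \<in> S i" using PQ that assms(3) by (auto simp: S_def)
    qed
    show "S i \<inter> S j = {}" if "i < n" "j < n" "i \<noteq> j" for i j
    proof -
      have "S i \<subseteq> P i j" "S j \<subseteq> Q i j" using that by (auto simp: S_def)
      then show ?thesis using PQ[OF that] by blast
    qed
  qed
qed

lemma compact_space_attains_inf:
  fixes f :: "'a \<Rightarrow> real"
  assumes "compact_space X" "topspace X \<noteq> {}" "continuous_map X euclideanreal f"
  shows "\<exists>p\<in>topspace X. \<forall>q\<in>topspace X. f p \<le> f q"
proof -
  have "compactin euclideanreal (f ` topspace X)"
    using image_compactin assms(1,3) unfolding compact_space_def by blast
  then have "compact (f ` topspace X)" by simp
  from compact_attains_inf[OF this] assms(2) show ?thesis by simp
qed

text \<open>A fixed minimum point \<open>p\<close> at \<open>u0\<close> serves as comparison. Off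
  \<open>A\<close> the value at \<open>u0\<close> is strictly larger than at \<open>p\<close>; as
  the complement of \<open>A\<close> is compact, the tube lemma preserves this strict inequality for
  all \<open>u\<close> near \<open>u0\<close>.\<close>

lemma min_points_near:
  assumes "compact_space (mtop M)" "continuous_map (prod_topology (mtop M) (mtop U)) euclideanreal F"
    and "u0 \<in> mcarrier U" "openin (mtop M) A" "min_points M F u0 \<subseteq> A" "p \<in> min_points M F u0"
  obtains B where "openin (mtop U) B" "u0 \<in> B" "\<And>u. u \<in> B \<Longrightarrow> min_points M F u \<subseteq> A"
proof -
  have p: "p \<in> mcarrier M" using assms(6) by (simp add: min_points_def)
  let ?Y = "prod_topology (mtop M) (mtop U)"
  define T where "T = {z \<in> topspace ?Y. F z - F (p, snd z) \<in> {0<..}}"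
  have "continuous_map ?Y ?Y (\<lambda>z. (p, snd z))"
    using p by (intro continuous_map_pairedI) (simp_all add: continuous_map_snd)
  then have "continuous_map ?Y euclideanreal (\<lambda>z. F (p, snd z))"
    using continuous_map_compose[OF _ assms(2)] by (fastforce simp: comp_def)
  then have "continuous_map ?Y euclideanreal (\<lambda>z. F z - F (p, snd z))"
    using assms(2) by (intro continuous_map_diff)
  then have T: "openin ?Y T"
    unfolding T_def by (rule openin_continuous_map_preimage) simp
  have K: "compactin (mtop M) (mcarrier M - A)"
    using assms(1,4) by (intro closedin_compact_space) auto
  have sub: "(mcarrier M - A) \<times> {u0} \<subseteq> T"
  proof
    fix z assume "z \<in> (mcarrier M - A) \<times> {u0}"
    then obtain x where x: "z = (x, u0)" "x \<in> mcarrier M" "x \<notin> min_points M F u0"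
      using assms(5) by auto
    then obtain q where "q \<in> mcarrier M" "F (q, u0) < F (x, u0)"
      by (auto simp: min_points_def not_le)
    moreover have "F (p, u0) \<le> F (q, u0)" using assms(6) \<open>q \<in> mcarrier M\<close> by (simp add: min_points_def)
    ultimately show "z \<in> T" using x assms(3) by (simp add: T_def)
  qed
  obtain P B where B: "openin (mtop U) B" "u0 \<in> B" "mcarrier M - A \<subseteq> P" "P \<times> B \<subseteq> T"
    using tube_lemma_left[OF T K assms(3) sub] by (elim exE conjE)
  have "min_points M F u \<subseteq> A" if "u \<in> B" for u
  proof (rule ccontr)
    assume "\<not> ?thesis"
    then obtain x where x: "x \<in> min_points M F u" "x \<notin> A" by blast
    then have "x \<in> P" using B(3) by (auto simp: min_points_def)
    then have "F (p, u) < F (x, u)" using B(4) that by (auto simp: T_def)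
    moreover have "F (x, u) \<le> F (p, u)" using x(1) p by (simp add: min_points_def)
    ultimately show False by simp
  qed
  with B(1,2) show thesis by (rule that)
qed

section \<open>Transport of the Maxwell set germ by \<open>\<psi>\<close>\<close>

theorem Maxwell_set_germ_diffeomorphic_model:
  fixes M :: "('m, real^2) manifold" and U :: "('u, real^3) manifold"
    and Gs :: "((real^2) \<times> (real^3) \<Rightarrow> real) list"
  assumes M: "smooth_manifold M" and compact: "compact_space (mtop M)"
    and U: "smooth_manifold U" and "u0 \<in> mcarrier U"
    and F: "smooth_map (prod_manifold M U) (euclid_manifold :: (real, real) manifold) F"
    and equiv: "right_equiv_at_min M U F u0 Gs"
    and "Gs \<noteq> []" and dom: "\<And>G. G \<in> set Gs \<Longrightarrow> dominated_by_origin G"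
  shows "diffeomorphic_set_germs U (Maxwell_set M U F) u0 euclid_manifold (model_Maxwell Gs) 0"
proof -
  define n where "n = length Gs"
  have "0 < n" using \<open>Gs \<noteq> []\<close> by (simp add: n_def)
  obtain ps \<psi> \<alpha> where "length ps = length Gs" "distinct ps" "set ps = min_points M F u0"
    and \<psi>: "diffeo_germ U u0 (euclid_manifold :: (real^3, real^3) manifold) 0 \<psi>"
    and ex\<phi>: "\<forall>i<length Gs. \<exists>\<phi>. smooth_germ (prod_manifold M U) (ps ! i, u0)
             (euclid_manifold :: (real^2, real^2) manifold) 0 \<phi> \<and>
           diffeo_germ M (ps ! i) (euclid_manifold :: (real^2, real^2) manifold) 0
             (\<lambda>x. \<phi> (x, u0)) \<and>
           (\<exists>N. openin (mtop (prod_manifold M U)) N \<and> (ps ! i, u0) \<in> N \<and>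
              (\<forall>(x, u)\<in>N. F (x, u) = (Gs ! i) (\<phi> (x, u), \<psi> u) + \<alpha> u))"
    using equiv unfolding right_equiv_at_min_def by blast
  then have ps: "length ps = n" "distinct ps" "set ps = min_points M F u0" by (simp_all add: n_def)
  obtain V W where "u0 \<in> V" and \<psi>V: "diffeo_on U euclid_manifold V W \<psi>" and "\<psi> u0 = 0"
    using \<psi> unfolding diffeo_germ_def by blast
  have "openin (mtop U) V" and cont: "continuous_map (subtopology (mtop U) V) euclidean \<psi>"
    and cont': "openin euclidean W" "continuous_map (subtopology euclidean W) (mtop U) (inv_into V \<psi>)"
    and bij: "bij_betw \<psi> V W"
    using \<psi>V unfolding diffeo_on_def smooth_map_on_def by (simp_all add: euclid_manifold_def)
  have "continuous_map (mtop (prod_manifold M U)) euclideanreal F"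
    using F unfolding smooth_map_def smooth_map_on_def by (simp add: euclid_manifold_def)
  then have contF: "continuous_map (prod_topology (mtop M) (mtop U)) euclideanreal F"
    by (simp add: prod_manifold_def)

  have ps_carrier: "p \<in> mcarrier M" if "p \<in> set ps" for p
    using that by (simp add: ps(3) min_points_def)
  obtain S where S: "\<And>i. i < n \<Longrightarrow> openin (mtop M) (S i) \<and> ps ! i \<in> S i"
    and S_disjoint: "\<And>i j. i < n \<Longrightarrow> j < n \<Longrightarrow> i \<noteq> j \<Longrightarrow> S i \<inter> S j = {}"
  proof (rule Hausdorff_space_separate_finite)
    show "Hausdorff_space (mtop M)" using M by (simp add: smooth_manifold_def)
    show "inj_on ((!) ps) {..<n}" using ps(1,2) by (simp add: inj_on_nth)
    show "(!) ps ` {..<n} \<subseteq> mcarrier M" using ps_carrier ps(1) by auto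
  qed blast
  have "\<exists>\<phi> A B r. openin (mtop M) A \<and> openin (mtop U) B \<and> ps ! i \<in> A \<and> u0 \<in> B \<and> A \<subseteq> S i \<and> 0 < r \<and>
      (\<forall>u\<in>B. inj_on (\<lambda>x. \<phi> (x, u)) A \<and> ball 0 r \<subseteq> (\<lambda>x. \<phi> (x, u)) ` A \<and>
         (\<forall>x\<in>A. F (x, u) = (Gs ! i) (\<phi> (x, u), \<psi> u) + \<alpha> u) \<and>
         (\<forall>y. r \<le> norm y \<longrightarrow> (Gs ! i) (0, \<psi> u) < (Gs ! i) (y, \<psi> u)))"
    if i: "i < n" for i
  proof -
    obtain \<phi> N where \<phi>: "smooth_germ (prod_manifold M U) (ps ! i, u0)
             (euclid_manifold :: (real^2, real^2) manifold) 0 \<phi>"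
           "diffeo_germ M (ps ! i) (euclid_manifold :: (real^2, real^2) manifold) 0
             (\<lambda>x. \<phi> (x, u0))"
      and N: "openin (mtop (prod_manifold M U)) N" "(ps ! i, u0) \<in> N"
             "\<forall>(x, u)\<in>N. F (x, u) = (Gs ! i) (\<phi> (x, u), \<psi> u) + \<alpha> u"
      using ex\<phi> i unfolding n_def by blast
    \<comment> \<open>The factor \<open>S i\<close> makes the neighbourhoods of different minimum
      points disjoint.\<close>
    let ?N = "N \<inter> (S i \<times> V)"
    have "openin (mtop (prod_manifold M U)) (S i \<times> V)"
      using S[OF i] \<open>openin (mtop U) V\<close> by (simp add: prod_manifold_def openin_prod_Times_iff)
    then have N': "openin (mtop (prod_manifold M U)) ?N" "(ps ! i, u0) \<in> ?N"
      using N S[OF i] \<open>u0 \<in> V\<close> by auto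
    obtain A B r where AB: "openin (mtop M) A" "openin (mtop U) B" "ps ! i \<in> A" "u0 \<in> B"
        "A \<times> B \<subseteq> ?N" "0 < r"
      and inj: "\<And>u. u \<in> B \<Longrightarrow> inj_on (\<lambda>x. \<phi> (x, u)) A"
      and surj: "\<And>u. u \<in> B \<Longrightarrow> ball 0 r \<subseteq> (\<lambda>x. \<phi> (x, u)) ` A"
      using manifold_fibrewise_inverse_function[OF M U \<phi> N'] by metis
    have "Gs ! i \<in> set Gs" using i by (simp add: n_def)
    from dom[OF this] \<open>0 < r\<close> obtain e where e: "0 < e"
      "\<And>v y. v \<in> ball 0 e \<Longrightarrow> r \<le> norm y \<Longrightarrow> (Gs ! i) (0, v) < (Gs ! i) (y, v)"
      unfolding dominated_by_origin_def by metis
    \<comment> \<open>The radius \<open>r\<close> is fixed first, by the inverse function theorem;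
      the parameters are then restricted so that \<open>\<psi> u\<close> lies where domination holds
      for this \<open>r\<close>.\<close>
    define B' where "B' = B \<inter> {u \<in> topspace (subtopology (mtop U) V). \<psi> u \<in> ball 0 e}"
    have "openin (subtopology (mtop U) V) {u \<in> topspace (subtopology (mtop U) V). \<psi> u \<in> ball 0 e}"
      by (rule openin_continuous_map_preimage[OF cont]) simp
    then have "openin (mtop U) B'"
      unfolding B'_def using AB(2) \<open>openin (mtop U) V\<close> by (simp add: openin_open_subtopology openin_Int)
    moreover have "u0 \<in> B'"
      using AB(4) \<open>u0 \<in> V\<close> \<open>u0 \<in> mcarrier U\<close> \<open>\<psi> u0 = 0\<close> e(1) by (simp add: B'_def)
    moreover have "A \<subseteq> S i" using AB(4,5) by blast
    moreover have "F (x, u) = (Gs ! i) (\<phi> (x, u), \<psi> u) + \<alpha> u" if "u \<in> B'" "x \<in> A" for u x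
    proof -
      have "(x, u) \<in> N" using that AB(5) by (auto simp: B'_def)
      then show ?thesis using N(3) by blast
    qed
    moreover have "(Gs ! i) (0, \<psi> u) < (Gs ! i) (y, \<psi> u)" if "u \<in> B'" "r \<le> norm y" for u y
      using that e(2) by (simp add: B'_def)
    moreover have "inj_on (\<lambda>x. \<phi> (x, u)) A" "ball 0 r \<subseteq> (\<lambda>x. \<phi> (x, u)) ` A"
      if "u \<in> B'" for u
      using that inj surj by (simp_all add: B'_def)
    ultimately show ?thesis using AB(1,3,6)
      by (intro exI[of _ \<phi>] exI[of _ A] exI[of _ B'] exI[of _ r] conjI ballI allI impI) simp_all
  qed
  then obtain \<phi> A B r where *: "\<And>i. i < n \<Longrightarrow>
      openin (mtop M) (A i) \<and> openin (mtop U) (B i) \<and> ps ! i \<in> A i \<and> u0 \<in> B i \<and> A i \<subseteq> S i \<and> 0 < r i \<and>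
      (\<forall>u\<in>B i. inj_on (\<lambda>x. \<phi> i (x, u)) (A i) \<and> ball 0 (r i) \<subseteq> (\<lambda>x. \<phi> i (x, u)) ` A i \<and>
         (\<forall>x\<in>A i. F (x, u) = (Gs ! i) (\<phi> i (x, u), \<psi> u) + \<alpha> u) \<and>
         (\<forall>y. r i \<le> norm y \<longrightarrow> (Gs ! i) (0, \<psi> u) < (Gs ! i) (y, \<psi> u)))"
    by metis
  then have A: "openin (mtop M) (A i)" "ps ! i \<in> A i" "A i \<subseteq> S i"
    and B: "openin (mtop U) (B i)" "u0 \<in> B i" and r: "0 < r i" if "i < n" for i
    using that by simp_all
  have inj: "inj_on (\<lambda>x. \<phi> i (x, u)) (A i)"
    and surj: "ball 0 (r i) \<subseteq> (\<lambda>x. \<phi> i (x, u)) ` A i"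
    and F_eq: "\<And>x. x \<in> A i \<Longrightarrow> F (x, u) = (Gs ! i) (\<phi> i (x, u), \<psi> u) + \<alpha> u"
    and Gs_less: "\<And>y. r i \<le> norm y \<Longrightarrow> (Gs ! i) (0, \<psi> u) < (Gs ! i) (y, \<psi> u)"
    if "i < n" "u \<in> B i" for i u
    using *[OF that(1)] that(2) by simp_all
  have "openin (mtop M) (\<Union>i<n. A i)" using A(1) by (intro openin_Union) auto
  moreover have "min_points M F u0 \<subseteq> (\<Union>i<n. A i)"
  proof
    fix p assume "p \<in> min_points M F u0"
    then obtain i where "i < n" "p = ps ! i" using ps by (metis in_set_conv_nth)
    then show "p \<in> (\<Union>i<n. A i)" using A(2) by blast
  qed
  moreover have p0: "ps ! 0 \<in> min_points M F u0"
    unfolding ps(3)[symmetric] using \<open>0 < n\<close> ps(1) by simp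
  ultimately obtain C where C: "openin (mtop U) C" "u0 \<in> C"
    and cover: "\<And>u. u \<in> C \<Longrightarrow> min_points M F u \<subseteq> (\<Union>i<n. A i)"
    using min_points_near[OF compact contF \<open>u0 \<in> mcarrier U\<close>] by metis
  define Z where "Z = (V \<inter> C) \<inter> (\<Inter>i<n. B i)"
  have "openin (mtop U) Z"
    unfolding Z_def using B(1) \<open>openin (mtop U) V\<close> C(1) by (intro openin_Int_Inter) auto
  have "u0 \<in> Z" using B(2) \<open>u0 \<in> V\<close> C(2) by (auto simp: Z_def)
  have key: "u \<in> Maxwell_set M U F \<longleftrightarrow> \<psi> u \<in> model_Maxwell Gs" if "u \<in> Z" for u
  proof -
    have u: "u \<in> mcarrier U" "u \<in> C" "\<And>i. i < n \<Longrightarrow> u \<in> B i"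
      using that \<open>openin (mtop U) Z\<close> openin_subset by (auto simp: Z_def)
    have "continuous_map (mtop M) (prod_topology (mtop M) (mtop U)) (\<lambda>x. (x, u))"
      using u(1) by (intro continuous_map_pairedI) simp_all
    from continuous_map_compose[OF this contF]
    have contFu: "continuous_map (mtop M) euclideanreal (\<lambda>x. F (x, u))" by (simp add: comp_def)
    have "mcarrier M \<noteq> {}" using p0 unfolding min_points_def by blast
    from compact_space_attains_inf[OF compact this contFu]
    have "min_points M F u \<noteq> {}" unfolding min_points_def by blast
    then have "(\<exists>p\<in>min_points M F u. \<exists>q\<in>min_points M F u. p \<noteq> q) \<longleftrightarrow> \<psi> u \<in> model_Maxwell Gs"
      unfolding min_points_def
    proof (intro two_minimizers_iff_model_Maxwell[where A = A and r = r and \<Phi> = "\<lambda>i x. \<phi> i (x, u)"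
          and \<alpha> = "\<alpha> u"])
      show "{p \<in> mcarrier M. \<forall>q\<in>mcarrier M. F (p, u) \<le> F (q, u)} \<subseteq> (\<Union>i<length Gs. A i)"
        using cover[OF u(2)] by (simp add: min_points_def n_def)
      fix i assume i: "i < length Gs"
      then have i': "i < n" by (simp add: n_def)
      show "A i \<subseteq> mcarrier M" using openin_subset[OF A(1)[OF i']] .
      show "A i \<inter> A j = {}" if "j < length Gs" "i \<noteq> j" for j
        using A(3)[OF i'] A(3)[of j] S_disjoint[OF i', of j] that unfolding n_def by blast
      show "inj_on (\<lambda>x. \<phi> i (x, u)) (A i)" "ball 0 (r i) \<subseteq> (\<lambda>x. \<phi> i (x, u)) ` A i" "0 < r i"
        using inj surj r i' u(3) by blast+
      show "F (x, u) = (Gs ! i) (\<phi> i (x, u), \<psi> u) + \<alpha> u" if "x \<in> A i" for x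
        using F_eq i' u(3) that by blast
      show "(Gs ! i) (0, \<psi> u) < (Gs ! i) (y, \<psi> u)" if "r i \<le> norm y" for y
        using Gs_less i' u(3) that by blast
    qed blast
    then show ?thesis using u(1) by (simp add: Maxwell_set_def)
  qed
  have "same_set_germ euclid_manifold 0 (\<psi> ` (Maxwell_set M U F \<inter> V)) (model_Maxwell Gs)"
    unfolding same_set_germ_def
  proof (intro exI conjI)
    \<comment> \<open>Written as a preimage under the inverse of \<open>\<psi>\<close>, the set is
      open by continuity; below it is identified with the image of \<open>Z\<close>.\<close>
    let ?O = "{v \<in> topspace (subtopology euclidean W). inv_into V \<psi> v \<in> Z}"
    have "openin (subtopology euclidean W) ?O"
      by (rule openin_continuous_map_preimage[OF cont'(2) \<open>openin (mtop U) Z\<close>])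
    then have "openin euclidean ?O" using openin_trans_full cont'(1) by blast
    then show "openin (mtop euclid_manifold) ?O" by (simp only: euclid_manifold_def manifold.simps)
    have inv: "inv_into V \<psi> (\<psi> u) = u" if "u \<in> V" for u
      using bij that by (simp add: bij_betw_inv_into_left)
    have W: "W = \<psi> ` V" using bij by (simp add: bij_betw_def)
    have "Z \<subseteq> V" by (auto simp: Z_def)
    have O: "?O = \<psi> ` Z" using inv \<open>Z \<subseteq> V\<close> by (auto simp: W)
    show "0 \<in> ?O" unfolding O using \<open>u0 \<in> Z\<close> \<open>\<psi> u0 = 0\<close> by force
    show "\<psi> ` (Maxwell_set M U F \<inter> V) \<inter> ?O = model_Maxwell Gs \<inter> ?O"
      unfolding O
    proof (intro set_eqI iffI)
      fix v assume "v \<in> \<psi> ` (Maxwell_set M U F \<inter> V) \<inter> \<psi> ` Z"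
      then obtain u z where u: "u \<in> Maxwell_set M U F" "u \<in> V" "v = \<psi> u" and z: "z \<in> Z" "v = \<psi> z"
        by blast
      then have "u = z" using inv[of u] inv[of z] \<open>Z \<subseteq> V\<close> by auto
      then show "v \<in> model_Maxwell Gs \<inter> \<psi> ` Z" using key u z by auto
    next
      fix v assume "v \<in> model_Maxwell Gs \<inter> \<psi> ` Z"
      then show "v \<in> \<psi> ` (Maxwell_set M U F \<inter> V) \<inter> \<psi> ` Z" using key \<open>Z \<subseteq> V\<close> by auto
    qed
  qed
  then show ?thesis
    unfolding diffeomorphic_set_germs_def using \<open>u0 \<in> V\<close> \<open>\<psi> u0 = 0\<close> \<psi>V by blast
qed

theorem mainTheorem2:
  fixes M :: "('m, real^2) manifold"
    and U :: "('u, real^3) manifold"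
    and F :: "'m \<times> 'u \<Rightarrow> real"
    and u0 :: 'u
  assumes "smooth_manifold M" and "compact_space (mtop M)"
    and "smooth_manifold U"
    and "diffeomorphic_manifolds U (euclid_manifold :: (real^3, real^3) manifold)"
    and "u0 \<in> mcarrier U"
    and "smooth_map (prod_manifold M U) (euclid_manifold :: (real, real) manifold) F"
  shows
    "(right_equiv_at_min M U F u0
        [\<lambda>(x, u). (x$1)^2 + (x$2)^2] \<longrightarrow>
      diffeomorphic_set_germs U (Maxwell_set M U F) u0 euclid_manifold
        ({} :: (real^3) set) 0)
   \<and> (right_equiv_at_min M U F u0
        [\<lambda>(x, u). (x$1)^2 + (x$2)^2 + u$1,
         \<lambda>(x, u). (x$1)^2 + (x$2)^2] \<longrightarrow>
      diffeomorphic_set_germs U (Maxwell_set M U F) u0 euclid_manifold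
        {u :: real^3. u$1 = 0} 0)
   \<and> (right_equiv_at_min M U F u0
        [\<lambda>(x, u). (x$1)^2 + (x$2)^2 + u$1,
         \<lambda>(x, u). (x$1)^2 + (x$2)^2 + u$2,
         \<lambda>(x, u). (x$1)^2 + (x$2)^2] \<longrightarrow>
      diffeomorphic_set_germs U (Maxwell_set M U F) u0 euclid_manifold
        ({u :: real^3. u$1 = u$2 \<and> u$2 \<le> 0} \<union> {u. u$1 = 0 \<and> 0 \<le> u$2} \<union> {u. u$2 = 0 \<and> 0 \<le> u$1}) 0)
   \<and> (right_equiv_at_min M U F u0
        [\<lambda>(x, u). (x$1)^2 + (x$2)^2 + u$1,
         \<lambda>(x, u). (x$1)^2 + (x$2)^2 + u$2,
         \<lambda>(x, u). (x$1)^2 + (x$2)^2 + u$3,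
         \<lambda>(x, u). (x$1)^2 + (x$2)^2] \<longrightarrow>
      diffeomorphic_set_germs U (Maxwell_set M U F) u0 euclid_manifold
        ({u :: real^3. u$1 = u$2 \<and> u$2 \<le> min (u$3) 0}
           \<union> {u. u$2 = u$3 \<and> u$3 \<le> min (u$1) 0}
           \<union> {u. u$3 = u$1 \<and> u$1 \<le> min (u$2) 0}
           \<union> {u. u$1 = 0 \<and> 0 \<le> min (u$2) (u$3)}
           \<union> {u. u$2 = 0 \<and> 0 \<le> min (u$1) (u$3)}
           \<union> {u. u$3 = 0 \<and> 0 \<le> min (u$1) (u$2)}) 0)
   \<and> (right_equiv_at_min M U F u0
        [\<lambda>(x, u). (x$1)^4 + u$2 * (x$1)^2 + u$1 * x$1 + (x$2)^2] \<longrightarrow>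
      diffeomorphic_set_germs U (Maxwell_set M U F) u0 euclid_manifold
        {u :: real^3. u$1 = 0 \<and> u$2 < 0} 0)
   \<and> (right_equiv_at_min M U F u0
        [\<lambda>(x, u). (x$1)^4 + u$2 * (x$1)^2 + u$1 * x$1 + (x$2)^2 + u$3,
         \<lambda>(x, u). (x$1)^2 + (x$2)^2] \<longrightarrow>
      diffeomorphic_set_germs U (Maxwell_set M U F) u0 euclid_manifold
        ({u :: real^3. u$1 = 0 \<and> u$2 < 0 \<and> u$3 \<le> (u$2)^2 / 4}
           \<union> {u. 0 \<le> (u$2)^2 + 12 * u$3 \<and> 0 \<le> sqrt ((u$2)^2 + 12 * u$3) - u$2 \<and>
                 \<bar>u$1\<bar> = sqrt 2 / (3 * sqrt 3) * (sqrt ((u$2)^2 + 12 * u$3) + 2 * u$2)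
                          * sqrt (sqrt ((u$2)^2 + 12 * u$3) - u$2)}) 0)"
proof -
  \<comment> \<open>The lists \<open>Gs'\<close> are built from \<open>A1\<close> and
    \<open>A3\<close>, while \<open>Gs\<close> holds the explicit functions. Their equality is a
    separate premise because it needs simplification, for instance to drop a zero additive
    term.\<close>
  have germ: "right_equiv_at_min M U F u0 Gs \<longrightarrow>
      diffeomorphic_set_germs U (Maxwell_set M U F) u0 euclid_manifold X 0"
    if "model_Maxwell Gs' = X" "\<forall>G\<in>set Gs'. dominated_by_origin G" "Gs' = Gs" "Gs \<noteq> []" for Gs Gs' X
    using Maxwell_set_germ_diffeomorphic_model[OF assms(1-3,5,6), of Gs] that by blast
  show ?thesis
    by (intro conjI
        germ[OF model_Maxwell_A1x1[of "\<lambda>u. 0"]] germ[OF model_Maxwell_A1x2]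
        germ[OF model_Maxwell_A1x3] germ[OF model_Maxwell_A1x4]
        germ[OF model_Maxwell_A3] germ[OF model_Maxwell_A3_A1])
      ((simp add: dominated_by_origin_A1 dominated_by_origin_A3; fail) | (simp add: A1_def A3_def; fail))+
qed

end
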